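(* Let $\beta\in k^\times$, $X^*=\beta\cdot\sqrt\varpi\in\mathfrak t_\varpi^*$, and let $s,\theta'\in k^\times$, $Y=s\cdot\sqrt{\theta'}\in\mathfrak t_{\theta'}$. If $\operatorname{depth}(X^* )+\operatorname{depth}(Y)=0$, and $Y$ lies in a ramified torus that is not stably conjugate to $\mathbf T_\varpi$, then $$M^G_{X^*}(Y)=\tfrac12\,q^{-(h+1)}\cdot q^{-1/2}|D_{\mathfrak g}(Y)|^{-1/2}\sum_{Z\in(\mathfrak t_\varpi)_{r:r+}}\Phi(\langle X^*,Z\rangle)\operatorname{sgn}_\varpi(Y^2-Z^2),$$ where the scalar matrices $Y^2$ and $Z^2$ are identified with elements of $k$ in the natural way.
   Context: $k$ is a non-discrete non-Archimedean local field of residual characteristic $\ne 2$, with ring of integers $\mathcal O$, maximal ideal $\mathfrak p$, valuation $\operatorname{ord}$ with value group $\mathbb Z$, residue field of order $q$, $|x|=q^{-\operatorname{ord}(x)}$; $\varpi$ is a uniformiser. $dx$ (or $dt$) is the Haar measure on $k$ giving $\mathcal O$ measure $1$, and $d^\times x=|x|^{-1}dx$. $\Phi$ is a non-trivial additive character of $k$. $k_\varpi=k(\sqrt\varpi)$, $N_\varpi(a+b\sqrt\varpi)=a^2-b^2\varpi$, and $\operatorname{sgn}_\varpi$ is the quadratic character of $k^\times$ with kernel $N_\varpi(k_\varpi^\times)$. $\mathfrak g=\mathfrak{sl}_2(k)$ with dual $\mathfrak g^*$ and pairing $\langle\cdot,\cdot\rangle$. For $\theta\in k^\times$, $\mathbf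 T_\theta=\{\begin{pmatrix}a&b\\ b\theta&a\end{pmatrix}:a^2-b^2\theta=1\}$, with Lie algebra $\mathfrak t_\theta=k\cdot\sqrt\theta$, where here $\sqrt\theta$ denotes the matrix $\begin{pmatrix}0&1\\ \theta&0\end{pmatrix}$. $X^*=\beta\sqrt\varpi$ means the functional $Z\mapsto\mathrm{Tr}(\beta\sqrt\varpi Z)$ on $\mathfrak g$. $Y$ lies in $\mathbf T_{\theta'}$, its centraliser. $\mathbf T_{\theta'}$ is ramified iff $\theta'$ is a non-square with $\operatorname{ord}(\theta')$ odd, and is stably conjugate to $\mathbf T_\varpi$ iff $\theta'\in\varpi(k^\times)^2$. $D_{\mathfrak g}\begin{pmatrix}a&b\\c&-a\end{pmatrix}=4(a^2+bc)$. Depth: $\operatorname{depth}(c\sqrt\theta)=\tfrac12\operatorname{ord}(c^2\theta)$ for $c\sqrt\theta\in\mathfrak t_\theta$; $\operatorname{depth}(X^* )$ is the largest real $\rho$ such that $\Phi(\langle X^*,Z\rangle)=1$ for all $Z\in\mathfrak t_\varpi$ with $\operatorname{depth}(Z)>-\rho$. Put $r=-\operatorname{depth}(X^* )$ and $h=r+\tfrac12\in\mathbb Z$. $(\mathfrak t_\varpi)_{r:r+}$ is the quotient of $\{Z\in\mathfrak t_\varpi:\operatorname{depth}(Z)\ge r\}$ by $\{Z\in\mathfrak t_\varpi:\operatorname{depth}(Z)>r\}$ (with $\operatorname{depth}(0)=\infty$); the summand depends only on the class of $Z$. Mock Fourier transform: $$M^G_{X^*}(Y)=\sum_{n\in\mathbb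 Z}\int_{\operatorname{ord}(x)=n}\mathbf 1_{N_\varpi(k_\varpi^\times)}(x)\Bigl(\sum_{l\in\mathbb Z}\int_{\operatorname{ord}(t)=l}\Phi\bigl(\beta s(x\theta'+x^{-1}\varpi-x^{-1}t^2)\bigr)\,dt\Bigr)d^\times x,$$ where $\mathbf 1_S$ is the characteristic function of $S$. *)

theory Defs
  imports "HOL-Analysis.Analysis"
begin

section \<open>Non-Archimedean local fields\<close>

text \<open>The valuation is normalised, with value group \<open>\<int>\<close>; the integer \<open>ord 0\<close> carries no
  information, so the case \<open>x = 0\<close> is always treated separately.\<close>

class valued_field = field +
  fixes ord :: "'a \<Rightarrow> int"
  assumes ord_mult: "x \<noteq> 0 \<Longrightarrow> y \<noteq> 0 \<Longrightarrow> ord (x * y) = ord x + ord y"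
    and ord_add: "x \<noteq> 0 \<Longrightarrow> y \<noteq> 0 \<Longrightarrow> x + y \<noteq> 0 \<Longrightarrow> min (ord x) (ord y) \<le> ord (x + y)"
    and ord_range: "ord ` (UNIV - {0}) = UNIV"

definition (in valued_field) val_ring :: "'a set" where
  "val_ring = {x. x = 0 \<or> ord x \<ge> 0}"

definition (in valued_field) max_ideal :: "'a set" where
  "max_ideal = {x. x = 0 \<or> ord x > 0}"

definition (in valued_field) residue_field :: "'a set set" where
  "residue_field = val_ring // {(x, y). x \<in> val_ring \<and> y \<in> val_ring \<and> x - y \<in> max_ideal}"

definition (in valued_field) residue_card :: "'a itself \<Rightarrow> nat" where
  "residue_card _ = card (residue_field :: 'a set set)"

definition (in valued_field) abs_val :: "'a \<Rightarrow> real" where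
  "abs_val x = (if x = 0 then 0 else real (residue_card TYPE('a)) powi (- ord x))"

text \<open>Completeness for the metric of the absolute value together with finiteness of the residue
  field amounts to local compactness; the topology and the Borel sets are those of this metric.\<close>

class nonarch_local_field = valued_field + complete_space +
  assumes finite_residue_field: "finite residue_field"
    and dist_abs_val: "dist x y = abs_val (x - y)"

definition uniformiser :: "'k::valued_field \<Rightarrow> bool" where
  "uniformiser \<pi> \<longleftrightarrow> \<pi> \<noteq> 0 \<and> ord \<pi> = 1"

definition shell :: "int \<Rightarrow> 'k::valued_field set" where
  "shell n = {x. x \<noteq> 0 \<and> ord x = n}"

definition additive_character :: "('k::nonarch_local_field \<Rightarrow> complex) \<Rightarrow> bool" where
  "additive_character \<Phi> \<longleftrightarrow>
     continuous_on UNIV \<Phi> \<and> (\<forall>x. norm (\<Phi> x) = 1) \<and> (\<forall>x y. \<Phi> (x + y) = \<Phi> x * \<Phi> y)"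

text \<open>The Haar measure \<open>dx\<close> on the additive group, normalised on the ring of integers (it is
  thereby unique, and finite on compact sets), and \<open>|x|\<^sup>-\<^sup>1 dx\<close>.\<close>

definition normalised_haar :: "'k::nonarch_local_field measure \<Rightarrow> bool" where
  "normalised_haar \<mu> \<longleftrightarrow> sets \<mu> = sets borel \<and>
     (\<forall>a. \<forall>A \<in> sets borel. emeasure \<mu> ((\<lambda>x. a + x) ` A) = emeasure \<mu> A) \<and>
     emeasure \<mu> val_ring = 1"

definition mult_haar :: "'k::nonarch_local_field measure \<Rightarrow> 'k measure" where
  "mult_haar \<mu> = density \<mu> (\<lambda>x. ennreal (inverse (abs_val x)))"

text \<open>The group of nonzero norms from \<open>k(\<surd>\<pi>)\<close>, where the pair \<open>(a, b)\<close> stands for \<open>a + b \<surd>\<pi>\<close>, and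
  the character of the nonzero elements of \<open>k\<close> with values \<open>\<plusminus>1\<close> and this group as kernel, extended by \<open>0\<close>.\<close>

definition norm_group :: "'k::field \<Rightarrow> 'k set" where
  "norm_group \<pi> = (\<lambda>(a, b). a\<^sup>2 - b\<^sup>2 * \<pi>) ` (UNIV - {(0, 0)})"

definition quad_char :: "'k::field \<Rightarrow> 'k \<Rightarrow> int" where
  "quad_char \<pi> x = (if x = 0 then 0 else if x \<in> norm_group \<pi> then 1 else - 1)"


section \<open>Tori in \<open>SL\<^sub>2\<close> and their Lie algebras\<close>

definition smult_mat :: "'k::field \<Rightarrow> 'k^2^2 \<Rightarrow> 'k^2^2" where
  "smult_mat c A = (\<chi> i j. c * A $ i $ j)"

definition sqrt_mat :: "'k::field \<Rightarrow> 'k^2^2" where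
  "sqrt_mat \<theta> = vector [vector [0, 1], vector [\<theta>, 0]]"

definition torus_lie :: "'k::field \<Rightarrow> ('k^2^2) set" where
  "torus_lie \<theta> = range (\<lambda>c. smult_mat c (sqrt_mat \<theta>))"

text \<open>The following two predicates concern the torus of determinant-one matrices
  \<open>(a, b; b\<theta>, a)\<close>, which determines \<open>\<theta>\<close>. It is ramified when it splits over a ramified
  quadratic extension \<open>k(\<surd>\<theta>)\<close> (in odd residual characteristic), and its stable conjugacy class
  corresponds to the class of \<open>\<theta>\<close> modulo nonzero squares.\<close>

definition ramified_torus :: "'k::valued_field \<Rightarrow> bool" where
  "ramified_torus \<theta> \<longleftrightarrow> \<theta> \<noteq> 0 \<and> (\<nexists>y. \<theta> = y\<^sup>2) \<and> odd (ord \<theta>)"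

definition stably_conjugate_tori :: "'k::field \<Rightarrow> 'k \<Rightarrow> bool" where
  "stably_conjugate_tori \<theta> \<theta>' \<longleftrightarrow> (\<exists>v. v \<noteq> 0 \<and> \<theta> = \<theta>' * v\<^sup>2)"

definition disc_g :: "'k::field^2^2 \<Rightarrow> 'k" where
  "disc_g A = 4 * ((A $ 1 $ 1)\<^sup>2 + A $ 1 $ 2 * A $ 2 $ 1)"

definition scalar_of_mat :: "'k::field^2^2 \<Rightarrow> 'k" where
  "scalar_of_mat A = (THE c. A = mat c)"

definition trace_functional :: "'k::field^2^2 \<Rightarrow> 'k^2^2 \<Rightarrow> 'k" where
  "trace_functional A = (\<lambda>Z. trace (A ** Z))"


section \<open>Depth\<close>

text \<open>Meaningful for \<open>Z \<in> torus_lie \<theta>\<close>; the upper right entry of \<open>c \<surd>\<theta>\<close> is \<open>c\<close>.\<close>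

definition depth :: "'k::valued_field \<Rightarrow> 'k^2^2 \<Rightarrow> ereal" where
  "depth \<theta> Z = (if Z = 0 then \<infinity> else ereal (real_of_int (ord ((Z $ 1 $ 2)\<^sup>2 * \<theta>)) / 2))"

definition dual_depth ::
    "('k::valued_field \<Rightarrow> complex) \<Rightarrow> 'k \<Rightarrow> ('k^2^2 \<Rightarrow> 'k) \<Rightarrow> real" where
  "dual_depth \<Phi> \<theta> X =
     (GREATEST \<rho>. \<forall>Z \<in> torus_lie \<theta>. depth \<theta> Z > ereal (- \<rho>) \<longrightarrow> \<Phi> (X Z) = 1)"

definition torus_ge :: "'k::valued_field \<Rightarrow> real \<Rightarrow> ('k^2^2) set" where
  "torus_ge \<theta> r = {Z \<in> torus_lie \<theta>. depth \<theta> Z \<ge> ereal r}"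

definition torus_gt :: "'k::valued_field \<Rightarrow> real \<Rightarrow> ('k^2^2) set" where
  "torus_gt \<theta> r = {Z \<in> torus_lie \<theta>. depth \<theta> Z > ereal r}"

definition torus_quotient :: "'k::valued_field \<Rightarrow> real \<Rightarrow> ('k^2^2) set set" where
  "torus_quotient \<theta> r =
     torus_ge \<theta> r // {(Z, W). Z \<in> torus_ge \<theta> r \<and> W \<in> torus_ge \<theta> r \<and> Z - W \<in> torus_gt \<theta> r}"


section \<open>The mock Fourier transform\<close>

text \<open>\<open>M\<^sup>G\<close> at \<open>X\<^sup>* = \<beta> \<surd>\<pi>\<close> and \<open>Y = s \<surd>\<theta>\<close>. Both sums over \<open>\<int>\<close> converge absolutely: the inner terms vanish
  for \<open>l\<close> very negative and are \<open>O(q\<^sup>-\<^sup>l)\<close> otherwise, and only finitely many outer terms are nonzero.\<close>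

definition mock_fourier ::
    "('k::nonarch_local_field \<Rightarrow> complex) \<Rightarrow> 'k measure \<Rightarrow> 'k \<Rightarrow> 'k \<Rightarrow> 'k \<Rightarrow> 'k \<Rightarrow> complex" where
  "mock_fourier \<Phi> \<mu> \<pi> \<beta> \<theta> s =
     (\<Sum>\<^sub>\<infinity>n\<in>(UNIV :: int set). LINT x:shell n|mult_haar \<mu>.
        indicator (norm_group \<pi>) x *
        (\<Sum>\<^sub>\<infinity>l\<in>(UNIV :: int set). LINT t:shell l|\<mu>.
           \<Phi> (\<beta> * s * (x * \<theta> + inverse x * \<pi> - inverse x * t\<^sup>2))))"

end

theory Submission
  imports Defs
begin

text \<open>Substituting \<open>x \<mapsto> x + u\<close> and \<open>t \<mapsto> t + u\<close> for small \<open>u\<close> and averaging annihilates all shells on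
  which the phase oscillates. What is left of the mock Fourier transform is a Kloosterman-type sum of
  \<open>\<psi>((\<epsilon>y + y\<^sup>-\<^sup>1) / 2)\<close> over the squares \<open>y\<close> of the residue field, where \<open>\<theta>' = \<epsilon>\<pi>v\<^sup>2\<close> with a non-square unit \<open>\<epsilon>\<close>.
  Since \<open>\<epsilon>\<close> is not a square, \<open>y \<mapsto> (\<epsilon>y + y\<^sup>-\<^sup>1) / 2\<close> is a bijection from the nonzero squares onto the residues \<open>w\<close>
  with \<open>w\<^sup>2 - \<epsilon>\<close> a square. On the other side, \<open>sgn(Y\<^sup>2 - Z\<^sup>2)\<close> is the quadratic character of
  \<open>w\<^sup>2 - \<epsilon>\<close>, and \<open>\<Sum>\<psi>(w) = 0\<close> turns the character into twice the indicator of the squares.\<close>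

section \<open>Valuations and fractional ideals\<close>

text \<open>The depth condition balances valuations. Let c be the conductor exponent of \<Phi>, so
  that \<Phi> induces a nontrivial character of the residue field at level c - 1. The two parts
  \<open>\<beta> * s * \<theta>' * x\<close> and \<open>\<beta> * s * \<pi> / x\<close> of the phase
  have valuations with sum 2(c - 1), so they reach level c - 1 on the same shell, and on every other
  shell one of them oscillates alone. On the common shell the coefficient of
  \<open>t\<^sup>2\<close> has valuation c - 2. Rescaling t changes this by even amounts, so no
  shell in t meets level c - 1: no Gauss sum appears and the inner integral is just a volume. That
  \<epsilon> is not a square also makes \<open>w\<^sup>2 - \<epsilon>\<close> a unit for every
  integral w, so \<open>Y\<^sup>2 - Z\<^sup>2\<close> has constant valuation and its sign depends
  only on the class of Z. Powers of \<open>- \<pi>\<close>, not of \<pi>, serve as scaling factors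
  because \<open>- \<pi>\<close> is a norm.\<close>

lemma ord_one [simp]: "ord (1 :: 'k::valued_field) = 0"
  using ord_mult[of "1::'k" 1] by simp

lemma ord_inverse: "x \<noteq> 0 \<Longrightarrow> ord (inverse x) = - ord (x :: 'k::valued_field)"
  using ord_mult[of x "inverse x"] by simp

lemma ord_minus [simp]: "ord (- x) = ord (x :: 'k::valued_field)"
proof (cases "x = 0")
  case False
  have "ord (-1 :: 'k) = 0"
    using ord_mult[of "-1::'k" "-1"] by simp
  then show ?thesis
    using ord_mult[of "-1" x] False by simp
qed simp

lemma ord_power: "x \<noteq> 0 \<Longrightarrow> ord (x ^ n) = int n * ord (x :: 'k::valued_field)"
  by (induction n) (simp_all add: ord_mult algebra_simps)

lemma ord_power_int: "x \<noteq> 0 \<Longrightarrow> ord (x powi n) = n * ord (x :: 'k::valued_field)"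
  by (cases "n \<ge> 0") (simp_all add: power_int_def ord_power ord_inverse)

text \<open>Congruences are stated as membership of a difference in these ideals; the clause for 0
  shields them from the uninformative integer \<open>ord 0\<close>.\<close>

definition frac_ideal :: "int \<Rightarrow> 'k::valued_field set" where
  "frac_ideal n = {x. x = 0 \<or> ord x \<ge> n}"

lemma val_ring_eq: "val_ring = frac_ideal 0"
  by (simp add: val_ring_def frac_ideal_def)

lemma max_ideal_eq: "max_ideal = frac_ideal 1"
  by (auto simp: max_ideal_def frac_ideal_def)

lemma zero_in_frac_ideal [simp]: "0 \<in> frac_ideal n"
  by (simp add: frac_ideal_def)

lemma frac_ideal_mono: "x \<in> frac_ideal m \<Longrightarrow> n \<le> m \<Longrightarrow> x \<in> frac_ideal n"
  by (auto simp: frac_ideal_def)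

lemma frac_ideal_add: "x \<in> frac_ideal n \<Longrightarrow> y \<in> frac_ideal n \<Longrightarrow> x + y \<in> frac_ideal n"
  using ord_add[of x y] unfolding frac_ideal_def by force

lemma frac_ideal_minus_iff [simp]: "- x \<in> frac_ideal n \<longleftrightarrow> x \<in> frac_ideal n"
  by (simp add: frac_ideal_def)

lemma frac_ideal_diff: "x \<in> frac_ideal n \<Longrightarrow> y \<in> frac_ideal n \<Longrightarrow> x - y \<in> frac_ideal n"
  using frac_ideal_add[of x n "- y"] by simp

lemma frac_ideal_diff_commute: "x - y \<in> frac_ideal n \<longleftrightarrow> y - x \<in> frac_ideal n"
  using frac_ideal_minus_iff[of "x - y" n] by (simp del: frac_ideal_minus_iff)

lemma frac_ideal_mult: "x \<in> frac_ideal m \<Longrightarrow> y \<in> frac_ideal n \<Longrightarrow> x * y \<in> frac_ideal (m + n)"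
  using ord_mult[of x y] unfolding frac_ideal_def by force

lemma frac_ideal_mult': "x \<in> frac_ideal m \<Longrightarrow> y \<in> frac_ideal n \<Longrightarrow> k \<le> m + n \<Longrightarrow> x * y \<in> frac_ideal k"
  using frac_ideal_mult frac_ideal_mono by blast

lemma frac_ideal_square: "x \<in> frac_ideal n \<Longrightarrow> k \<le> 2 * n \<Longrightarrow> x\<^sup>2 \<in> frac_ideal k"
  using frac_ideal_mult'[of x n x n k] by (simp add: power2_eq_square)

lemma shell_subset: "x \<in> shell n \<Longrightarrow> m \<le> n \<Longrightarrow> x \<in> frac_ideal m"
  by (simp add: shell_def frac_ideal_def)

lemma shell_nonzero: "x \<in> shell n \<Longrightarrow> x \<noteq> 0"
  by (simp add: shell_def)

lemma shell_eq: "shell n = frac_ideal n - frac_ideal (n + 1)"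
  by (auto simp: shell_def frac_ideal_def)

lemma shell_mult: "x \<in> shell m \<Longrightarrow> y \<in> shell n \<Longrightarrow> x * y \<in> shell (m + n)"
  by (simp add: shell_def ord_mult)

lemma shell_inverse: "x \<in> shell n \<Longrightarrow> inverse x \<in> shell (- n)"
  by (simp add: shell_def ord_inverse)

lemma shell_divide: "x \<in> shell m \<Longrightarrow> y \<in> shell n \<Longrightarrow> x / y \<in> shell (m - n)"
  using shell_mult[OF _ shell_inverse] by (fastforce simp: divide_inverse)

lemma shell_minus: "x \<in> shell m \<Longrightarrow> - x \<in> shell m"
  by (simp add: shell_def)

lemma shell_power: "x \<in> shell n \<Longrightarrow> x ^ k \<in> shell (int k * n)"
  by (simp add: shell_def ord_power)

lemma shell_power_int: "x \<in> shell n \<Longrightarrow> x powi k \<in> shell (k * n)"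
  by (simp add: shell_def ord_power_int)

lemma shell_add: "x \<in> shell n \<Longrightarrow> u \<in> frac_ideal (n + 1) \<Longrightarrow> x + u \<in> shell n"
  using frac_ideal_diff[of "x + u" "n + 1" u] frac_ideal_add[of x n u] frac_ideal_mono[of u "n + 1" n]
  by (auto simp: shell_eq)

lemma frac_ideal_divide_shell:
  "x \<in> frac_ideal m \<Longrightarrow> y \<in> shell n \<Longrightarrow> k \<le> m - n \<Longrightarrow> x / y \<in> frac_ideal k"
  using frac_ideal_mult'[OF _ shell_subset[OF shell_inverse order_refl], of x m y n k]
  by (simp add: divide_inverse)

text \<open>The remainder is exactly \<open>u\<^sup>2 / (x\<^sup>2 * (x + u))\<close>, and k \<ge> 1
  keeps x + u on the shell of x, so its valuation is at least 2(n + k) - 3n. The quadratic gain is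
  what later isolates the linear term of a phase.\<close>

lemma inverse_add_expansion:
  assumes x: "x \<in> shell n" and u: "u \<in> frac_ideal (n + k)" and k: "k \<ge> 1"
  shows "inverse (x + u) - (inverse x - u / x\<^sup>2) \<in> frac_ideal (2 * k - n)"
proof -
  have xu: "x + u \<in> shell n"
    using shell_add[OF x frac_ideal_mono[OF u]] k by simp
  have "x \<noteq> 0" "x + u \<noteq> 0"
    using x xu by (auto simp: shell_def)
  then have "inverse (x + u) - (inverse x - u / x\<^sup>2) = u\<^sup>2 / (x\<^sup>2 * (x + u))"
    by (simp add: divide_simps) algebra
  moreover have "u\<^sup>2 \<in> frac_ideal (2 * (n + k))"
    using frac_ideal_square[OF u] by simp
  moreover have "x\<^sup>2 * (x + u) \<in> shell (3 * n)"
    using shell_mult[OF shell_power[OF x, of 2] xu] by (simp add: algebra_simps)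
  ultimately show ?thesis
    using frac_ideal_divide_shell[of "u\<^sup>2" "2 * (n + k)" "x\<^sup>2 * (x + u)" "3 * n"] by simp
qed

lemma inverse_add_cong:
  fixes x :: "'k::valued_field"
  assumes x: "x \<in> shell n" and u: "u \<in> frac_ideal (n + 1)"
  shows "inverse (x + u) - inverse x \<in> frac_ideal (1 - n)"
proof -
  have "(inverse (x + u) - (inverse x - u / x\<^sup>2)) - u / x\<^sup>2 \<in> frac_ideal (1 - n)"
    using frac_ideal_mono[OF inverse_add_expansion[OF x u], of "1 - n"]
      frac_ideal_divide_shell[OF u shell_power[OF x, of 2], of "1 - n"]
    by (simp only: frac_ideal_diff)
  then show ?thesis
    by simp
qed

section \<open>Residues\<close>

text \<open>Sums over the residue field are written as sums over chosen elements of k, at which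
  \<Phi> and \<open>is_square\<close> can be evaluated directly. The class of 0 need not be
  represented by 0.\<close>

definition residue_reps :: "'k::valued_field set" where
  "residue_reps = (\<lambda>C. SOME x. x \<in> C) ` residue_field"

definition residue_rep :: "'k::valued_field \<Rightarrow> 'k" where
  "residue_rep x = (SOME w. w \<in> residue_reps \<and> x - w \<in> frac_ideal 1)"

definition residue_rel :: "('k::valued_field \<times> 'k) set" where
  "residue_rel = {(x, y). x \<in> val_ring \<and> y \<in> val_ring \<and> x - y \<in> max_ideal}"

lemma residue_field_eq: "(residue_field :: 'k::valued_field set set) = val_ring // residue_rel"
  by (simp add: residue_field_def residue_rel_def)

lemma equiv_residue_rel: "equiv val_ring (residue_rel :: ('k::valued_field \<times> 'k) set)"
proof (rule equivI)
  show "refl_on val_ring (residue_rel :: ('k \<times> 'k) set)"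
    by (auto simp: refl_on_def residue_rel_def max_ideal_def)
  show "sym (residue_rel :: ('k \<times> 'k) set)"
    by (auto simp: sym_def residue_rel_def max_ideal_eq frac_ideal_diff_commute)
  have "x - z \<in> frac_ideal 1" if "x - y \<in> frac_ideal 1" "y - z \<in> frac_ideal 1" for x y z :: 'k
    using frac_ideal_add[OF that] by simp
  then show "trans (residue_rel :: ('k \<times> 'k) set)"
    unfolding trans_def residue_rel_def max_ideal_eq by blast
qed (auto simp: residue_rel_def)

lemma some_in_residue_class:
  fixes C :: "'k::valued_field set"
  assumes "C \<in> residue_field"
  shows "(SOME x. x \<in> C) \<in> C"
  using in_quotient_imp_non_empty[OF equiv_residue_rel] assms
  by (auto simp: residue_field_eq some_in_eq)

lemma residue_reps_subset: "residue_reps \<subseteq> (frac_ideal 0 :: 'k::valued_field set)"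
proof
  fix w :: 'k
  assume "w \<in> residue_reps"
  then obtain C where "C \<in> residue_field" "w = (SOME x. x \<in> C)"
    by (auto simp: residue_reps_def)
  then show "w \<in> frac_ideal 0"
    using some_in_residue_class in_quotient_imp_subset[OF equiv_residue_rel]
    by (fastforce simp: residue_field_eq val_ring_eq)
qed

lemma residue_reps_eqI:
  fixes v w :: "'k::valued_field"
  assumes "v \<in> residue_reps" "w \<in> residue_reps" "v - w \<in> frac_ideal 1"
  shows "v = w"
proof -
  obtain C D where C: "C \<in> residue_field" "v = (SOME x. x \<in> C)"
    and D: "D \<in> residue_field" "w = (SOME x. x \<in> D)"
    using assms by (auto simp: residue_reps_def)
  have "(v, w) \<in> residue_rel"
    using assms residue_reps_subset by (auto simp: residue_rel_def val_ring_eq max_ideal_eq)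
  then have "C = D"
    using quotient_eq_iff[OF equiv_residue_rel, of C D v w] some_in_residue_class C D
    by (auto simp: residue_field_eq)
  then show ?thesis
    using C D by simp
qed

lemma residue_rep:
  fixes x :: "'k::valued_field"
  assumes "x \<in> frac_ideal 0"
  shows "residue_rep x \<in> residue_reps" "x - residue_rep x \<in> frac_ideal 1"
proof -
  let ?C = "residue_rel `` {x}"
  have C: "?C \<in> residue_field"
    using assms by (simp add: residue_field_eq quotientI val_ring_eq)
  define w where "w = (SOME w. w \<in> ?C)"
  have "w \<in> ?C"
    unfolding w_def using C by (rule some_in_residue_class)
  moreover have "w \<in> residue_reps"
    unfolding residue_reps_def w_def using C by (rule imageI)
  ultimately have "w \<in> residue_reps \<and> x - w \<in> frac_ideal 1"
    by (simp add: residue_rel_def max_ideal_eq)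
  then have "residue_rep x \<in> residue_reps \<and> x - residue_rep x \<in> frac_ideal 1"
    unfolding residue_rep_def by (rule someI)
  then show "residue_rep x \<in> residue_reps" "x - residue_rep x \<in> frac_ideal 1"
    by auto
qed

lemma residue_rep_cong:
  fixes x y :: "'k::valued_field"
  assumes x: "x \<in> frac_ideal 0" and y: "y \<in> frac_ideal 0"
  shows "residue_rep x = residue_rep y \<longleftrightarrow> x - y \<in> frac_ideal 1"
proof
  assume "residue_rep x = residue_rep y"
  then show "x - y \<in> frac_ideal 1"
    using frac_ideal_diff[OF residue_rep(2)[OF x] residue_rep(2)[OF y]] by simp
next
  assume "x - y \<in> frac_ideal 1"
  then have "(x - y) - (x - residue_rep x) + (y - residue_rep y) \<in> frac_ideal 1"
    using residue_rep(2)[OF x] residue_rep(2)[OF y]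
    by (meson frac_ideal_add frac_ideal_diff)
  then show "residue_rep x = residue_rep y"
    using residue_rep(1)[OF x] residue_rep(1)[OF y] by (intro residue_reps_eqI) auto
qed

lemma residue_rep_unit: "x \<in> shell 0 \<Longrightarrow> residue_rep x \<in> shell 0"
  using shell_add[of x 0 "residue_rep x - x"] residue_rep(2)[of x] shell_subset[of x 0 0]
  by (simp add: frac_ideal_diff_commute)

lemma card_residue_reps: "card (residue_reps :: 'k::valued_field set) = residue_card TYPE('k)"
proof -
  have "inj_on (\<lambda>C. SOME x. x \<in> C) (residue_field :: 'k set set)"
  proof (rule inj_onI)
    fix C D :: "'k set"
    assume *: "C \<in> residue_field" "D \<in> residue_field" "(SOME x. x \<in> C) = (SOME x. x \<in> D)"
    then have "(SOME x. x \<in> C) \<in> C \<inter> D"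
      using some_in_residue_class[of C] some_in_residue_class[of D] by auto
    then show "C = D"
      using * quotient_disj[OF equiv_residue_rel] by (auto simp: residue_field_eq)
  qed
  then show ?thesis
    by (simp add: residue_reps_def residue_card_def card_image)
qed

lemma finite_residue_reps: "finite (residue_reps :: 'k::nonarch_local_field set)"
  unfolding residue_reps_def by (rule finite_imageI[OF finite_residue_field])

lemma residue_card_gt_1: "residue_card TYPE('k::nonarch_local_field) > 1"
proof -
  have "residue_rep (1::'k) \<noteq> residue_rep 0"
    by (subst residue_rep_cong) (auto simp: frac_ideal_def)
  moreover have "{residue_rep (1::'k), residue_rep 0} \<subseteq> residue_reps"
    using residue_rep(1)[of "1::'k"] residue_rep(1)[of "0::'k"] by (simp add: frac_ideal_def)
  ultimately have "card {residue_rep (1::'k), residue_rep 0} \<le> card (residue_reps :: 'k set)"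
    by (intro card_mono finite_residue_reps)
  with \<open>residue_rep (1::'k) \<noteq> residue_rep 0\<close> show ?thesis
    by (simp add: card_residue_reps)
qed

lemma abs_val_shell: "x \<in> shell n \<Longrightarrow> abs_val x = real (residue_card TYPE('k)) powi (- n)"
  for x :: "'k::valued_field"
  by (simp add: shell_def abs_val_def)

text \<open>The dictionary between metric and valuation; it rests on q > 1, which makes
  \<open>q powi (- n)\<close> strictly decreasing in n.\<close>

lemma abs_val_le_iff:
  "abs_val x \<le> real (residue_card TYPE('k)) powi (- n) \<longleftrightarrow> x \<in> frac_ideal n"
  for x :: "'k::nonarch_local_field"
proof -
  have q: "real (residue_card TYPE('k)) > 1"
    using residue_card_gt_1[where 'k = 'k] by simp
  then show ?thesis
    using power_int_strict_increasing[OF _ q, of "- n" "- ord x"]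
      power_int_increasing[of "- ord x" "- n" "real (residue_card TYPE('k))"]
    by (auto simp: abs_val_def frac_ideal_def not_le) (meson leD leI neg_less_iff_less)
qed

definition unit_reps :: "'k::valued_field set" where
  "unit_reps = residue_reps \<inter> shell 0"

lemma residue_rep_in_unit_reps: "x \<in> shell 0 \<Longrightarrow> residue_rep x \<in> unit_reps"
  using residue_rep(1)[OF shell_subset] residue_rep_unit by (auto simp: unit_reps_def)

lemma finite_unit_reps: "finite (unit_reps :: 'k::nonarch_local_field set)"
  by (simp add: unit_reps_def finite_residue_reps)

lemma residue_rep_eqI:
  fixes x w :: "'k::valued_field"
  assumes w: "w \<in> residue_reps" and xw: "x - w \<in> frac_ideal 1"
  shows "residue_rep x = w"
proof -
  have w0: "w \<in> frac_ideal 0"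
    using w residue_reps_subset by auto
  then have x0: "x \<in> frac_ideal 0"
    using frac_ideal_add[of "x - w" 0 w] frac_ideal_mono[OF xw, of 0] by simp
  show ?thesis
    using frac_ideal_diff[OF xw residue_rep(2)[OF x0]] residue_rep(1)[OF x0] w
    by (intro residue_reps_eqI) auto
qed

section \<open>Squares in odd residual characteristic\<close>

lemma shell_two:
  assumes "(2 :: 'k::valued_field) \<notin> max_ideal"
  shows "(2 :: 'k) \<in> shell 0"
proof -
  have "(1 :: 'k) + 1 \<in> frac_ideal 0"
    by (intro frac_ideal_add) (auto simp: frac_ideal_def)
  then show ?thesis
    using assms by (simp add: shell_eq max_ideal_eq)
qed

text \<open>Raising the valuation of a difference by one shrinks the distance by the factor 1/q. The
  second hypothesis covers z = w, where \<open>ord (z - w)\<close> means nothing.\<close>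

lemma residual_contraction:
  fixes z w z' w' :: "'k::nonarch_local_field"
  assumes diff: "z' - w' \<in> frac_ideal (ord (z - w) + 1)" and eq: "z = w \<Longrightarrow> z' = w'"
  shows "dist z' w' \<le> inverse (real (residue_card TYPE('k))) * dist z w"
proof (cases "z = w")
  case False
  let ?q = "real (residue_card TYPE('k))"
  have "dist z' w' \<le> ?q powi (- (ord (z - w) + 1))"
    using diff by (simp only: dist_abs_val abs_val_le_iff)
  also have "\<dots> = inverse ?q * dist z w"
    using False residue_card_gt_1[where 'k = 'k]
    by (simp add: dist_abs_val abs_val_def power_int_diff power_int_minus divide_inverse
        power_int_add)
  finally show ?thesis .
qed (use eq in simp)

lemma diff_in_frac_ideal_iff:
  "x - y \<in> frac_ideal n \<longleftrightarrow> dist x y \<le> real (residue_card TYPE('k)) powi (- n)"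
  for x y :: "'k::nonarch_local_field"
  by (simp add: dist_abs_val abs_val_le_iff)

lemma frac_ideal_eq_cball:
  "(\<lambda>u. x + u) ` frac_ideal n = cball x (real (residue_card TYPE('k)) powi (- n))"
  for x :: "'k::nonarch_local_field"
proof (intro set_eqI iffI)
  fix y
  assume "y \<in> cball x (real (residue_card TYPE('k)) powi (- n))"
  then have "y - x \<in> frac_ideal n"
    by (simp add: diff_in_frac_ideal_iff dist_commute)
  then show "y \<in> (\<lambda>u. x + u) ` frac_ideal n"
    by (intro image_eqI[of _ _ "y - x"]) auto
qed (auto simp: dist_abs_val abs_val_le_iff)

text \<open>Hensel's lemma: \<open>1 + z\<close> is a square root of \<open>1 + u\<close> iff \<open>z\<close> is a fixed point of the
  contraction \<open>z \<mapsto> (u - z\<^sup>2) / 2\<close> of the maximal ideal.\<close>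

lemma one_unit_is_square:
  fixes u :: "'k::nonarch_local_field"
  assumes two: "(2 :: 'k) \<notin> max_ideal" and u: "u \<in> frac_ideal 1"
  shows "\<exists>y. 1 + u = y\<^sup>2"
proof -
  let ?q = "real (residue_card TYPE('k))" and ?f = "\<lambda>z. (u - z\<^sup>2) / 2"
  have q: "?q > 1"
    using residue_card_gt_1[where 'k = 'k] by simp
  have half: "x \<in> frac_ideal n \<Longrightarrow> x / 2 \<in> frac_ideal n" for x :: 'k and n
    using frac_ideal_divide_shell[OF _ shell_two[OF two]] by fastforce
  have "frac_ideal 1 = cball (0::'k) (?q powi (- 1))"
    using frac_ideal_eq_cball[of "0::'k" 1] by simp
  then have "complete (frac_ideal 1 :: 'k set)"
    by (metis complete_eq_closed closed_cball)
  moreover have "?f ` frac_ideal 1 \<subseteq> frac_ideal 1"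
    using u by (auto intro!: half frac_ideal_diff intro: frac_ideal_square)
  moreover have "dist (?f z) (?f w) \<le> inverse ?q * dist z w"
    if "z \<in> frac_ideal 1" "w \<in> frac_ideal 1" for z w
  proof (rule residual_contraction)
    have "z - w \<in> frac_ideal (ord (z - w))"
      by (simp add: frac_ideal_def)
    \<comment> \<open>The factor z + w lies in the maximal ideal and provides the extra unit of
      valuation.\<close>
    then have "(w - z) * (z + w) \<in> frac_ideal (ord (z - w) + 1)"
      using that by (intro frac_ideal_mult frac_ideal_add) (simp_all add: frac_ideal_diff_commute)
    then have "(w - z) * (z + w) / 2 \<in> frac_ideal (ord (z - w) + 1)"
      by (rule half)
    moreover have "(w - z) * (z + w) / 2 = ?f z - ?f w"
      by (simp add: diff_divide_distrib[symmetric] power2_eq_square algebra_simps)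
    ultimately show "?f z - ?f w \<in> frac_ideal (ord (z - w) + 1)"
      by simp
  qed simp
  moreover have "inverse ?q < 1"
    using q by (simp add: field_simps)
  moreover have "frac_ideal 1 \<noteq> ({} :: 'k set)"
    using zero_in_frac_ideal by blast
  ultimately have "\<exists>!z\<in>frac_ideal 1. ?f z = z"
    by (intro Banach_fix[where c = "inverse ?q"]) auto
  then obtain z where "?f z = z"
    by blast
  moreover have "(2::'k) \<noteq> 0"
    using shell_nonzero[OF shell_two[OF two]] .
  ultimately have "1 + u = (1 + z)\<^sup>2"
    by (simp add: field_simps power2_eq_square)
  then show ?thesis ..
qed

definition is_square :: "'k::monoid_mult \<Rightarrow> bool" where
  "is_square x \<longleftrightarrow> (\<exists>y. x = y\<^sup>2)"

lemma is_square_power2 [simp]: "is_square (x\<^sup>2)"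
  by (auto simp: is_square_def)

lemma is_square_mult_iff [simp]:
  "y \<noteq> 0 \<Longrightarrow> is_square (x * y\<^sup>2) \<longleftrightarrow> is_square x" for x :: "'k::field"
  unfolding is_square_def
  by (metis nonzero_mult_div_cancel_right power_divide power_mult_distrib power_not_zero)

lemma is_square_mult_iff' [simp]:
  "y \<noteq> 0 \<Longrightarrow> is_square (y\<^sup>2 * x) \<longleftrightarrow> is_square x" for x :: "'k::field"
  using is_square_mult_iff[of y x] by (simp add: mult.commute)

lemma even_ord_square: "x \<noteq> 0 \<Longrightarrow> is_square x \<Longrightarrow> even (ord (x :: 'k::valued_field))"
  by (auto simp: is_square_def ord_power)

section \<open>Local constancy of squares, norms from the ramified extension, index of the
  squares\<close>

context
  assumes two: "(2 :: 'k::nonarch_local_field) \<notin> max_ideal"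
begin

text \<open>Since \<open>x + u = x * (1 + u / x)\<close> and the second factor is a square by
  Hensel's lemma, only the leading term of x matters. This moves squareness between k and the
  residue field.\<close>

lemma is_square_cong:
  fixes x u :: 'k
  assumes x: "x \<in> shell n" and u: "u \<in> frac_ideal (n + 1)"
  shows "is_square (x + u) \<longleftrightarrow> is_square x"
proof -
  have "u / x \<in> frac_ideal 1"
    using frac_ideal_divide_shell[OF u x] by simp
  then obtain y where y: "1 + u / x = y\<^sup>2"
    using one_unit_is_square[OF two] by blast
  moreover have "x + u = x * (1 + u / x)"
    using shell_nonzero[OF x] by (simp add: field_simps)
  moreover have "x + u \<noteq> 0"
    using shell_nonzero[OF shell_add[OF x u]] .
  ultimately show ?thesis
    by auto
qed

lemma is_square_cong_diff:
  fixes x y :: 'k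
  shows "x \<in> shell n \<Longrightarrow> y - x \<in> frac_ideal (n + 1) \<Longrightarrow> is_square y \<longleftrightarrow> is_square x"
  using is_square_cong[of x n "y - x"] by simp

text \<open>A congruence of \<open>x\<^sup>2\<close> and \<epsilon> modulo the maximal ideal would
  make \<epsilon> a square by local constancy.\<close>

lemma square_diff_nonsquare_unit:
  fixes x \<epsilon> :: 'k
  assumes x: "x \<in> frac_ideal 0" and \<epsilon>: "\<epsilon> \<in> shell 0" "\<not> is_square \<epsilon>"
  shows "x\<^sup>2 - \<epsilon> \<in> shell 0"
proof -
  have "x\<^sup>2 - \<epsilon> \<in> frac_ideal 0"
    using frac_ideal_square[OF x, of 0] shell_subset[OF \<epsilon>(1), of 0] by (simp add: frac_ideal_diff)
  moreover have "x\<^sup>2 - \<epsilon> \<notin> frac_ideal 1"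
    using is_square_cong_diff[OF \<epsilon>(1), of "x\<^sup>2"] \<epsilon>(2) by auto
  ultimately show ?thesis
    by (simp add: shell_eq)
qed

text \<open>The terms \<open>a\<^sup>2\<close> and \<open>b\<^sup>2 * \<pi>\<close> have valuations
  of opposite parity, so one of them is the leading term of x, and local constancy of squareness
  discards the other. The norm group thus consists of the nonzero squares and their multiples by
  \<open>- \<pi>\<close>.\<close>

lemma norm_group_iff:
  fixes \<pi> x :: 'k
  assumes \<pi>: "uniformiser \<pi>"
  shows "x \<in> norm_group \<pi> \<longleftrightarrow> x \<noteq> 0 \<and> (is_square x \<or> is_square (- x / \<pi>))"
proof
  have [simp]: "\<pi> \<noteq> 0" and ord\<pi> [simp]: "ord \<pi> = 1"
    using \<pi> by (auto simp: uniformiser_def)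
  {
    assume "x \<in> norm_group \<pi>"
    then obtain a b where x: "x = a\<^sup>2 - b\<^sup>2 * \<pi>" and ab: "a \<noteq> 0 \<or> b \<noteq> 0"
      by (auto simp: norm_group_def)
    have xm: "- x / \<pi> = b\<^sup>2 - a\<^sup>2 / \<pi>"
      using x by (simp add: field_simps)
    \<comment> \<open>Equal valuations of a and b belong to the case in which
      \<open>a\<^sup>2\<close> dominates, because \<pi> adds one to the other term.\<close>
    consider "a = 0" | "b = 0" | "a \<noteq> 0" "b \<noteq> 0" "ord a \<le> ord b" | "a \<noteq> 0" "b \<noteq> 0" "ord b < ord a"
      by linarith
    then show "x \<noteq> 0 \<and> (is_square x \<or> is_square (- x / \<pi>))"
    proof cases
      case 3
      then have s: "a\<^sup>2 \<in> shell (2 * ord a)" "- (b\<^sup>2 * \<pi>) \<in> frac_ideal (2 * ord a + 1)"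
        by (auto simp: shell_def frac_ideal_def ord_power ord_mult)
      then show ?thesis
        using is_square_cong[OF s] shell_nonzero[OF shell_add[OF s]] by (simp add: x)
    next
      case 4
      then have s: "b\<^sup>2 \<in> shell (2 * ord b)" "- (a\<^sup>2 / \<pi>) \<in> frac_ideal (2 * ord b + 1)"
        by (auto simp: shell_def frac_ideal_def ord_power ord_mult ord_inverse divide_inverse)
      then show ?thesis
        using is_square_cong[OF s] shell_nonzero[OF shell_add[OF s]] by (auto simp: xm[symmetric])
    qed (use ab x xm in auto)
  }
  assume x: "x \<noteq> 0 \<and> (is_square x \<or> is_square (- x / \<pi>))"
  then obtain a where "x = a\<^sup>2 \<or> - x / \<pi> = a\<^sup>2"
    by (auto simp: is_square_def)
  then have "x = a\<^sup>2 - 0\<^sup>2 * \<pi> \<or> x = 0\<^sup>2 - a\<^sup>2 * \<pi>"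
    by (auto simp: field_simps minus_equation_iff[of x])
  then show "x \<in> norm_group \<pi>"
    using x unfolding norm_group_def by (elim disjE) (force, force)
qed

lemma norm_group_cong:
  fixes \<pi> x u :: 'k
  assumes \<pi>: "uniformiser \<pi>" and x: "x \<in> shell n" and u: "u \<in> frac_ideal (n + 1)"
  shows "x + u \<in> norm_group \<pi> \<longleftrightarrow> x \<in> norm_group \<pi>"
proof -
  have \<pi>': "\<pi> \<in> shell 1"
    using \<pi> by (simp add: uniformiser_def shell_def)
  have "is_square (- x / \<pi> + - u / \<pi>) \<longleftrightarrow> is_square (- x / \<pi>)"
    using u by (intro is_square_cong[OF shell_divide[OF shell_minus[OF x] \<pi>']]
        frac_ideal_divide_shell[OF _ \<pi>', of _ "n + 1"]) auto
  moreover have "- x / \<pi> + - u / \<pi> = - (x + u) / \<pi>"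
    by (simp add: diff_divide_distrib)
  ultimately have "is_square (- (x + u) / \<pi>) \<longleftrightarrow> is_square (- x / \<pi>)"
    by simp
  then show ?thesis
    using shell_nonzero[OF x] shell_nonzero[OF shell_add[OF x u]] is_square_cong[OF x u]
    by (simp add: norm_group_iff[OF \<pi>])
qed

lemma norm_group_even:
  fixes \<pi> x :: 'k
  assumes \<pi>: "uniformiser \<pi>" and x: "x \<noteq> 0" "even (ord x)"
  shows "x \<in> norm_group \<pi> \<longleftrightarrow> is_square x"
proof -
  have "odd (ord (- x / \<pi>))"
    using \<pi> x by (simp add: uniformiser_def divide_inverse ord_mult ord_inverse)
  moreover have "- x / \<pi> \<noteq> 0"
    using \<pi> x by (simp add: uniformiser_def)
  ultimately show ?thesis
    using x(1) even_ord_square[of "- x / \<pi>"] by (auto simp: norm_group_iff[OF \<pi>])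
qed

lemma norm_group_odd:
  fixes \<pi> x :: 'k
  assumes \<pi>: "uniformiser \<pi>" and x: "x \<noteq> 0" "odd (ord x)"
  shows "x \<in> norm_group \<pi> \<longleftrightarrow> is_square (- x / \<pi>)"
  using x even_ord_square[of x] by (auto simp: norm_group_iff[OF \<pi>])

lemma is_square_residue_rep: "x \<in> shell 0 \<Longrightarrow> is_square (residue_rep x) \<longleftrightarrow> is_square (x :: 'k)"
  using is_square_cong_diff[of x 0 "residue_rep x"] residue_rep(2)[of x] shell_subset[of x 0 0]
  by (simp add: frac_ideal_diff_commute)

text \<open>The element \<open>- \<pi>\<close> is the norm of the square root of \<pi>, so its
  powers do not affect membership, and a unit is a norm iff it is a square. With powers of \<pi> the
  answer would also depend on whether -1 is a square.\<close>

lemma norm_group_power_mult: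
  fixes \<pi> y :: 'k
  assumes \<pi>: "uniformiser \<pi>" and y: "y \<in> shell 0"
  shows "inverse ((- \<pi>) powi j) * y \<in> norm_group \<pi> \<longleftrightarrow> is_square y"
proof -
  have \<pi>0: "\<pi> \<noteq> 0" "ord \<pi> = 1"
    using \<pi> by (auto simp: uniformiser_def)
  have y0: "y \<noteq> 0" "ord y = 0"
    using y by (auto simp: shell_def)
  let ?x = "inverse ((- \<pi>) powi j) * y"
  have x: "?x \<noteq> 0" "ord ?x = - j"
    using \<pi>0 y0 by (simp_all add: ord_mult ord_inverse ord_power_int)
  have sq: "is_square (y * (- \<pi>) powi (2 * i)) \<longleftrightarrow> is_square y" for i
  proof -
    have "(- \<pi>) powi (2 * i) = ((- \<pi>) powi i)\<^sup>2"
      by (simp add: power_int_power' mult.commute)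
    then show ?thesis
      using \<pi>0 by simp
  qed
  show ?thesis
  proof (cases "even j")
    case True
    then obtain i where "j = 2 * i"
      by blast
    then have eq: "?x = y * (- \<pi>) powi (2 * - i)"
      by (simp add: power_int_minus del: power_int_minus_left_even)
    have "is_square ?x \<longleftrightarrow> is_square y"
      unfolding eq by (rule sq)
    then show ?thesis
      using norm_group_even[OF \<pi> x(1)] True unfolding x(2) by simp
  next
    case False
    then obtain i where i: "j = 2 * i + 1"
      by (elim oddE)
    have "(- \<pi>) powi (- (j + 1)) = inverse ((- \<pi>) powi j * - \<pi>)"
      using \<pi>0 by (subst power_int_minus) (simp add: power_int_add_1)
    then have "- ?x / \<pi> = y * (- \<pi>) powi (- (j + 1))"
      by (simp only:) (simp add: divide_inverse mult_ac)
    also have "- (j + 1) = 2 * (- i - 1)"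
      by (simp add: i)
    finally have eq: "- ?x / \<pi> = y * (- \<pi>) powi (2 * (- i - 1))" .
    have "is_square (- ?x / \<pi>) \<longleftrightarrow> is_square y"
      unfolding eq by (rule sq)
    then show ?thesis
      using norm_group_odd[OF \<pi> x(1)] False unfolding x(2) by simp
  qed
qed

text \<open>Squaring is two-to-one on residue classes of units: the roots a and -a differ by the
  unit 2a, and a root exists in k itself by definition of \<open>is_square\<close>.\<close>

lemma card_unit_squares: "card (unit_reps :: 'k set) = 2 * card {y \<in> unit_reps :: 'k set. is_square y}"
proof -
  let ?f = "\<lambda>y::'k. residue_rep (y\<^sup>2)" and ?S = "{y \<in> unit_reps :: 'k set. is_square y}"
  have sq: "y\<^sup>2 \<in> shell 0" if "y \<in> shell 0" for y :: 'k
    using shell_power[OF that, of 2] by simp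
  have fibre: "card {y \<in> unit_reps. ?f y = z} = 2" if z: "z \<in> ?S" for z
  proof -
    obtain a where a: "z = a\<^sup>2"
      using z by (auto simp: is_square_def)
    have za: "z \<noteq> 0" "ord z = 0"
      using z by (auto simp: unit_reps_def shell_def)
    then have aU: "a \<in> shell 0"
      by (auto simp: shell_def a ord_power)
    have a2: "2 * a \<in> shell 0"
      using shell_mult[OF shell_two[OF two] aU] by simp
    have "{y \<in> unit_reps. ?f y = z} = {residue_rep a, residue_rep (- a)}"
    proof (intro set_eqI iffI)
      fix y
      assume "y \<in> {y \<in> unit_reps. ?f y = z}"
      then have y: "y \<in> residue_reps" "y \<in> shell 0" "?f y = z"
        by (auto simp: unit_reps_def)
      then have "y\<^sup>2 - z \<in> frac_ideal 1"
        using residue_rep(2)[OF shell_subset[OF sq]] by fastforce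
      then have *: "(y - a) * (y + a) \<in> frac_ideal 1"
        by (simp add: a power2_eq_square algebra_simps)
      \<comment> \<open>The maximal ideal is prime: two integral elements outside it are units, and
        so is their product.\<close>
      have "y - a \<in> frac_ideal 1 \<or> y + a \<in> frac_ideal 1"
      proof (rule ccontr)
        assume "\<not> ?thesis"
        then have "y - a \<in> shell 0" "y + a \<in> shell 0"
          using shell_subset[OF y(2) order_refl] shell_subset[OF aU order_refl]
          by (auto simp: shell_eq frac_ideal_add frac_ideal_diff)
        then show False
          using * shell_mult[of "y - a" 0 "y + a" 0] by (auto simp: shell_eq)
      qed
      then have "residue_rep a = y \<or> residue_rep (- a) = y"
        using residue_rep_eqI[OF y(1), of a] residue_rep_eqI[OF y(1), of "- a"]
          frac_ideal_minus_iff[of "y + a" 1] by (auto simp: frac_ideal_diff_commute algebra_simps)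
      then show "y \<in> {residue_rep a, residue_rep (- a)}"
        by auto
    next
      fix y
      assume "y \<in> {residue_rep a, residue_rep (- a)}"
      then obtain b where b: "y = residue_rep b" "b\<^sup>2 = z" "b \<in> shell 0"
        using a aU shell_minus[OF aU] by auto
      have yU: "y \<in> unit_reps"
        using b residue_rep_in_unit_reps by simp
      have "y - b \<in> frac_ideal 1"
        using b residue_rep(2)[of b] by (simp add: frac_ideal_diff_commute shell_subset)
      moreover have "y + b \<in> frac_ideal 0"
        using yU b(3) by (intro frac_ideal_add) (auto simp: unit_reps_def shell_subset)
      ultimately have "(y - b) * (y + b) \<in> frac_ideal (1 + 0)"
        by (rule frac_ideal_mult)
      then have "y\<^sup>2 - z \<in> frac_ideal 1"
        by (simp add: b(2)[symmetric] power2_eq_square algebra_simps)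
      then have "?f y = z"
        using z by (intro residue_rep_eqI) (auto simp: unit_reps_def)
      then show "y \<in> {y \<in> unit_reps. ?f y = z}"
        using yU by simp
    qed
    moreover have "residue_rep a \<noteq> residue_rep (- a)"
      using a2 shell_subset[OF aU order_refl] by (subst residue_rep_cong) (auto simp: shell_eq)
    ultimately show ?thesis
      by simp
  qed
  have "?f ` unit_reps \<subseteq> ?S"
    using is_square_residue_rep residue_rep_in_unit_reps sq by (auto simp: unit_reps_def)
  then have "card (unit_reps :: 'k set) = (\<Sum>z\<in>?S. card {y \<in> unit_reps. ?f y = z})"
    using sum.group[of unit_reps ?S ?f "\<lambda>_. 1::nat"] finite_unit_reps[where 'k = 'k] by simp
  also have "\<dots> = 2 * card ?S"
    using fibre by simp
  finally show ?thesis .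
qed

text \<open>Multiplication by x maps square classes injectively to nonsquare classes. Both kinds are
  equally numerous, so the map is onto: y is congruent to x z with z a square, and x y to
  \<open>x\<^sup>2 * z\<close>.\<close>

lemma nonsquare_mult_nonsquare:
  fixes x y :: 'k
  assumes x: "x \<in> shell 0" "\<not> is_square x" and y: "y \<in> shell 0" "\<not> is_square y"
  shows "is_square (x * y)"
proof -
  let ?S = "{y \<in> unit_reps :: 'k set. is_square y}" and ?N = "{y \<in> unit_reps :: 'k set. \<not> is_square y}"
  let ?g = "\<lambda>z. residue_rep (x * z)"
  have xz: "x * z \<in> shell 0" if "z \<in> unit_reps" for z :: 'k
    using shell_mult[OF x(1)] that by (fastforce simp: unit_reps_def)
  have "?g ` ?S \<subseteq> ?N"
  proof clarify
    fix z :: 'k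
    assume z: "z \<in> unit_reps" "is_square z"
    then obtain w where "z = w\<^sup>2" "w \<noteq> 0"
      by (auto simp: is_square_def unit_reps_def shell_def)
    then have "\<not> is_square (x * z)"
      using x by simp
    then show "?g z \<in> unit_reps \<and> \<not> is_square (?g z)"
      using is_square_residue_rep[OF xz] residue_rep_in_unit_reps[OF xz] z by simp
  qed
  moreover have "inj_on ?g ?S"
  proof (rule inj_onI)
    fix z w :: 'k
    assume zw: "z \<in> ?S" "w \<in> ?S" "?g z = ?g w"
    then have "x * z - x * w \<in> frac_ideal 1"
      using residue_rep_cong[of "x * z" "x * w"] shell_subset[OF xz order_refl] by simp
    then have "(x * z - x * w) / x \<in> frac_ideal 1"
      by (rule frac_ideal_divide_shell[OF _ x(1)]) simp
    then show "z = w"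
      using zw shell_nonzero[OF x(1)]
      by (intro residue_reps_eqI) (auto simp: unit_reps_def diff_divide_distrib)
  qed
  moreover have "card ?N = card ?S"
  proof -
    have "card (unit_reps :: 'k set) = card ?S + card ?N"
      using finite_unit_reps[where 'k = 'k] by (subst card_Un_disjoint[symmetric]) (auto intro: arg_cong[where f = card])
    then show ?thesis
      using card_unit_squares by simp
  qed
  moreover have "finite ?N"
    using finite_unit_reps[where 'k = 'k] by simp
  ultimately have "?g ` ?S = ?N"
    by (metis card_image card_subset_eq)
  moreover have "residue_rep y \<in> ?N"
    using y is_square_residue_rep residue_rep_in_unit_reps by simp
  ultimately obtain z where z: "z \<in> unit_reps" "is_square z" "residue_rep y = residue_rep (x * z)"
    by auto
  then have "y - x * z \<in> frac_ideal 1"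
    using residue_rep_cong shell_subset[OF y(1) order_refl] shell_subset[OF xz order_refl] by blast
  then have "x * y - x * (x * z) \<in> frac_ideal (0 + 1)"
    using frac_ideal_mult[OF shell_subset[OF x(1) order_refl], of "y - x * z" 1]
    by (simp add: algebra_simps)
  moreover have "x * (x * z) \<in> shell 0"
    using shell_mult[OF x(1) xz[OF z(1)]] by simp
  ultimately have "is_square (x * y) \<longleftrightarrow> is_square (x\<^sup>2 * z)"
    using is_square_cong_diff[of "x * (x * z)" 0 "x * y"] by (simp add: power2_eq_square mult.assoc)
  then show ?thesis
    using z shell_nonzero[OF x(1)] by simp
qed

end

section \<open>Haar measure\<close>

text \<open>Such a set contains a ball of radius \<open>q powi (- n)\<close> around each of its
  points. All measurability of cosets, ideals and shells is obtained this way.\<close>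

lemma open_if_invariant:
  fixes S :: "'k::nonarch_local_field set"
  assumes "\<And>x u. x \<in> S \<Longrightarrow> u \<in> frac_ideal n \<Longrightarrow> x + u \<in> S"
  shows "open S"
proof -
  have "(0::real) < real (residue_card TYPE('k)) powi (- n)"
    using residue_card_gt_1[where 'k = 'k] by simp
  moreover have "y \<in> S" if "x \<in> S" "dist y x < real (residue_card TYPE('k)) powi (- n)" for x y
    using assms[of x "y - x"] that by (simp add: diff_in_frac_ideal_iff)
  ultimately show ?thesis
    unfolding open_dist by blast
qed

lemma open_coset: "open ((\<lambda>u. x + u) ` frac_ideal n)" for x :: "'k::nonarch_local_field"
  by (rule open_if_invariant[of _ n]) (auto simp: add.assoc intro: frac_ideal_add)

lemma open_frac_ideal: "open (frac_ideal n :: 'k::nonarch_local_field set)"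
  by (rule open_if_invariant[of _ n]) (rule frac_ideal_add)

lemma open_shell: "open (shell n :: 'k::nonarch_local_field set)"
  by (rule open_if_invariant[of _ "n + 1"]) (rule shell_add)

lemma shell_eq_UN:
  fixes a :: "'k::valued_field"
  assumes a: "a \<in> shell n"
  shows "shell n = (\<Union>y\<in>unit_reps. (\<lambda>u. a * y + u) ` frac_ideal (n + 1))"
proof (intro set_eqI iffI)
  fix x :: 'k
  assume x: "x \<in> shell n"
  then have y: "x / a \<in> shell 0"
    using shell_divide[OF x a] by simp
  then have "a * (x / a - residue_rep (x / a)) \<in> frac_ideal (n + 1)"
    by (intro frac_ideal_mult residue_rep shell_subset[OF a] shell_subset[OF y]) auto
  moreover have "x = a * residue_rep (x / a) + a * (x / a - residue_rep (x / a))"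
    using shell_nonzero[OF a] by (simp add: algebra_simps)
  ultimately show "x \<in> (\<Union>y\<in>unit_reps. (\<lambda>u. a * y + u) ` frac_ideal (n + 1))"
    using residue_rep_in_unit_reps[OF y] by blast
next
  fix x :: 'k
  assume "x \<in> (\<Union>y\<in>unit_reps. (\<lambda>u. a * y + u) ` frac_ideal (n + 1))"
  then show "x \<in> shell n"
    using shell_mult[OF a, of _ 0] by (auto simp: unit_reps_def intro: shell_add)
qed

lemma frac_ideal_eq_UN:
  fixes a :: "'k::valued_field"
  assumes a: "a \<in> shell n"
  shows "frac_ideal n = (\<Union>y\<in>residue_reps. (\<lambda>u. a * y + u) ` frac_ideal (n + 1))"
proof (intro set_eqI iffI)
  fix x :: 'k
  assume x: "x \<in> frac_ideal n"
  then have y: "x / a \<in> frac_ideal 0"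
    using frac_ideal_divide_shell[OF x a] by simp
  then have "a * (x / a - residue_rep (x / a)) \<in> frac_ideal (n + 1)"
    by (intro frac_ideal_mult residue_rep shell_subset[OF a]) auto
  moreover have "x = a * residue_rep (x / a) + a * (x / a - residue_rep (x / a))"
    using shell_nonzero[OF a] by (simp add: algebra_simps)
  ultimately show "x \<in> (\<Union>y\<in>residue_reps. (\<lambda>u. a * y + u) ` frac_ideal (n + 1))"
    using residue_rep(1)[OF y] by blast
next
  fix x :: 'k
  assume "x \<in> (\<Union>y\<in>residue_reps. (\<lambda>u. a * y + u) ` frac_ideal (n + 1))"
  then obtain y u where "y \<in> frac_ideal 0" "u \<in> frac_ideal (n + 1)" "x = a * y + u"
    using residue_reps_subset by blast
  then show "x \<in> frac_ideal n"
    using frac_ideal_mult[OF shell_subset[OF a order_refl], of y 0]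
    by (auto intro!: frac_ideal_add intro: frac_ideal_mono)
qed

lemma disjoint_residue_cosets:
  fixes a :: "'k::valued_field"
  assumes a: "a \<in> shell n"
  shows "disjoint_family_on (\<lambda>y. (\<lambda>u. a * y + u) ` frac_ideal (n + 1)) residue_reps"
proof (unfold disjoint_family_on_def, intro ballI impI, rule ccontr)
  fix v w :: 'k
  assume vw: "v \<in> residue_reps" "w \<in> residue_reps" "v \<noteq> w"
    and "(\<lambda>u. a * v + u) ` frac_ideal (n + 1) \<inter> (\<lambda>u. a * w + u) ` frac_ideal (n + 1) \<noteq> {}"
  then obtain u u' where u: "u \<in> frac_ideal (n + 1)" "u' \<in> frac_ideal (n + 1)" "a * v + u = a * w + u'"
    by blast
  then have "v - w = (u' - u) / a"
    using shell_nonzero[OF a] by (simp add: field_simps)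
  then have "v - w \<in> frac_ideal 1"
    using frac_ideal_divide_shell[OF frac_ideal_diff[OF u(2,1)] a] by simp
  with vw show False
    using residue_reps_eqI by blast
qed

lemma disjoint_unit_cosets:
  fixes a :: "'k::valued_field"
  assumes "a \<in> shell n"
  shows "disjoint_family_on (\<lambda>y. (\<lambda>u. a * y + u) ` frac_ideal (n + 1)) unit_reps"
  using disjoint_residue_cosets[OF assms] disjoint_family_on_mono[of unit_reps residue_reps]
  by (auto simp: unit_reps_def)

lemma shell_nonempty: "\<exists>a :: 'k::valued_field. a \<in> shell n"
proof -
  have "n \<in> ord ` (UNIV - {0 :: 'k})"
    by (simp add: ord_range)
  then show ?thesis
    by (auto simp: shell_def)
qed

lemma measurable_translate [measurable]: "(\<lambda>x. x + u) \<in> borel \<rightarrow>\<^sub>M (borel :: 'k::nonarch_local_field measure)"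
proof (rule borel_measurable_continuous_onI)
  show "continuous_on UNIV (\<lambda>x. x + u :: 'k)"
    unfolding continuous_on_iff by (auto simp: dist_abs_val)
qed

lemma q_gt_1: "q = real (residue_card TYPE('k::nonarch_local_field)) \<Longrightarrow> q > 1"
  using residue_card_gt_1[where 'k = 'k] by simp

section \<open>Integration from translation invariance and the normalisation\<close>

context
  fixes \<mu> :: "'k::nonarch_local_field measure"
  assumes haar: "normalised_haar \<mu>"
begin

lemma sets_haar [simp]: "sets \<mu> = sets borel"
  using haar by (simp add: normalised_haar_def)

lemma space_haar [simp]: "space \<mu> = UNIV"
  using sets_eq_imp_space_eq[OF sets_haar] by simp

lemma measurable_haar [simp]: "borel_measurable \<mu> = borel_measurable borel"
  by (rule measurable_cong_sets) simp_all

lemma emeasure_translate: "A \<in> sets borel \<Longrightarrow> emeasure \<mu> ((\<lambda>x. a + x) ` A) = emeasure \<mu> A"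
  using haar by (simp add: normalised_haar_def)

lemma distr_translate: "distr \<mu> borel (\<lambda>x. x + u) = \<mu>"
proof (rule measure_eqI)
  fix A
  assume "A \<in> sets (distr \<mu> borel (\<lambda>x. x + u))"
  then have A: "A \<in> sets borel"
    by simp
  have "(\<lambda>x. x + u) -` A = (\<lambda>x. - u + x) ` A"
    by (auto intro!: image_eqI[of _ _ "_ + u"])
  then show "emeasure (distr \<mu> borel (\<lambda>x. x + u)) A = emeasure \<mu> A"
    using A emeasure_translate[OF A, of "- u"] by (simp add: emeasure_distr)
qed simp

lemma integral_translate:
  fixes g :: "'k \<Rightarrow> complex"
  assumes "integrable \<mu> g"
  shows "integrable \<mu> (\<lambda>t. g (t + u))" "integral\<^sup>L \<mu> (\<lambda>t. g (t + u)) = integral\<^sup>L \<mu> g"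
proof -
  have g: "g \<in> borel_measurable borel"
    using borel_measurable_integrable[OF assms] by simp
  show "integral\<^sup>L \<mu> (\<lambda>t. g (t + u)) = integral\<^sup>L \<mu> g"
    using integral_distr[of "\<lambda>t. t + u" \<mu> borel g] g by (simp add: distr_translate)
  show "integrable \<mu> (\<lambda>t. g (t + u))"
    using integrable_distr_eq[of "\<lambda>t. t + u" \<mu> borel g] g assms by (simp add: distr_translate)
qed

text \<open>Each translate by an element of T has the same integral, so \<open>card T\<close> times
  the integral is the integral of the vanishing sum. If f is not integrable on S, its integral is 0
  by convention, in agreement with the conclusion.\<close>

lemma set_integral_vanish:
  fixes f :: "'k \<Rightarrow> complex"
  assumes T: "finite T" "T \<noteq> {}"
    and S: "\<And>t u. u \<in> T \<Longrightarrow> t + u \<in> S \<longleftrightarrow> t \<in> S"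
    and f: "\<And>t. t \<in> S \<Longrightarrow> (\<Sum>u\<in>T. f (t + u)) = 0"
  shows "(LINT t:S|\<mu>. f t) = 0"
proof (cases "integrable \<mu> (\<lambda>t. indicator S t *\<^sub>R f t)")
  case True
  let ?g = "\<lambda>t. indicator S t *\<^sub>R f t"
  have "of_nat (card T) * integral\<^sup>L \<mu> ?g = (\<Sum>u\<in>T. integral\<^sup>L \<mu> (\<lambda>t. ?g (t + u)))"
    using integral_translate[OF True] by simp
  also have "\<dots> = integral\<^sup>L \<mu> (\<lambda>t. \<Sum>u\<in>T. ?g (t + u))"
    using integral_translate[OF True] by (intro Bochner_Integration.integral_sum[symmetric])
  also have "(\<lambda>t. \<Sum>u\<in>T. ?g (t + u)) = (\<lambda>t. 0)"
  proof
    fix t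
    have "(\<Sum>u\<in>T. ?g (t + u)) = (\<Sum>u\<in>T. indicator S t *\<^sub>R f (t + u))"
      using S by (intro sum.cong) (auto simp: indicator_def)
    also have "\<dots> = indicator S t *\<^sub>R (\<Sum>u\<in>T. f (t + u))"
      by (rule scaleR_sum_right[symmetric])
    also have "\<dots> = 0"
      using f by (auto simp: indicator_def)
    finally show "(\<Sum>u\<in>T. ?g (t + u)) = 0" .
  qed
  finally show ?thesis
    using T by (simp add: set_lebesgue_integral_def)
qed (simp add: set_lebesgue_integral_def not_integrable_integral_eq)

lemma set_integral_const:
  fixes f :: "'k \<Rightarrow> complex"
  assumes "A \<in> sets borel" "emeasure \<mu> A < \<infinity>" "\<And>x. x \<in> A \<Longrightarrow> f x = c"
  shows "set_integrable \<mu> A f" "(LINT x:A|\<mu>. f x) = measure \<mu> A *\<^sub>R c"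
proof -
  have *: "(\<lambda>x. indicator A x *\<^sub>R f x) = (\<lambda>x. indicator A x *\<^sub>R c)"
    using assms(3) by (intro ext) (auto simp: indicator_def)
  show "set_integrable \<mu> A f" "(LINT x:A|\<mu>. f x) = measure \<mu> A *\<^sub>R c"
    using assms by (simp_all add: set_integrable_def set_lebesgue_integral_def *)
qed

context
  fixes q :: real
  assumes q_def: "q = real (residue_card TYPE('k))"
begin

lemma emeasure_frac_ideal_Suc:
  "emeasure \<mu> (frac_ideal n) = ennreal q * emeasure \<mu> (frac_ideal (n + 1))"
proof -
  obtain a :: 'k where a: "a \<in> shell n"
    using shell_nonempty by blast
  have "emeasure \<mu> (frac_ideal n) = (\<Sum>y\<in>residue_reps. emeasure \<mu> ((\<lambda>u. a * y + u) ` frac_ideal (n + 1)))"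
    unfolding frac_ideal_eq_UN[OF a]
    by (intro sum_emeasure[symmetric] disjoint_residue_cosets[OF a] finite_residue_reps)
      (auto simp: open_coset)
  then show ?thesis
    by (simp add: emeasure_translate open_frac_ideal card_residue_reps q_def ennreal_of_nat_eq_real_of_nat)
qed

lemma emeasure_frac_ideal: "emeasure \<mu> (frac_ideal n) = ennreal (q powi (- n))"
proof (induction n rule: int_induct[where k = 0])
  case base
  show ?case
    using haar by (simp add: normalised_haar_def val_ring_eq)
next
  case (step1 i)
  have "ennreal q * emeasure \<mu> (frac_ideal (i + 1)) = ennreal q * ennreal (q powi (- (i + 1)))"
    using q_gt_1[OF q_def] emeasure_frac_ideal_Suc[of i] step1
    by (simp add: ennreal_mult'[symmetric] power_int_diff power_int_minus power_int_add field_simps)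
  then show ?case
    using q_gt_1[OF q_def] by (subst (asm) ennreal_mult_cancel_left) (auto simp: ennreal_eq_0_iff)
next
  case (step2 i)
  then show ?case
    using q_gt_1[OF q_def] emeasure_frac_ideal_Suc[of "i - 1"]
    by (simp add: ennreal_mult'[symmetric] power_int_diff power_int_minus field_simps)
qed

lemma measure_frac_ideal: "measure \<mu> (frac_ideal n) = q powi (- n)"
  using emeasure_frac_ideal q_gt_1[OF q_def] by (simp add: measure_def)

lemma emeasure_coset: "emeasure \<mu> ((\<lambda>u. x + u) ` frac_ideal n) = ennreal (q powi (- n))"
  by (simp add: emeasure_translate open_frac_ideal emeasure_frac_ideal)

lemma measure_coset: "measure \<mu> ((\<lambda>u. x + u) ` frac_ideal n) = q powi (- n)"
  using emeasure_coset q_gt_1[OF q_def] by (simp add: measure_def)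

lemma measure_shell: "measure \<mu> (shell n) = q powi (- n) - q powi (- (n + 1))"
  unfolding shell_eq
  by (subst measure_Diff)
    (auto simp: measure_frac_ideal emeasure_frac_ideal open_frac_ideal intro: frac_ideal_mono)

text \<open>The integrand is constant on the cosets of \<open>frac_ideal (n + 1)\<close>, each of
  volume \<open>q powi (- (n + 1))\<close>; the choice of a only fixes the scale at which residues
  label these cosets.\<close>

lemma set_integral_shell:
  fixes f :: "'k \<Rightarrow> complex"
  assumes a: "a \<in> shell n"
    and f: "\<And>x u. x \<in> shell n \<Longrightarrow> u \<in> frac_ideal (n + 1) \<Longrightarrow> f (x + u) = f x"
  shows "(LINT x:shell n|\<mu>. f x) = of_real (q powi (- (n + 1))) * (\<Sum>y\<in>unit_reps. f (a * y))"
proof -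
  have const: "f x = f (a * y)" if "x \<in> (\<lambda>u. a * y + u) ` frac_ideal (n + 1)" "y \<in> unit_reps" for x y
    using that f[of "a * y"] shell_mult[OF a, of y 0] by (auto simp: unit_reps_def)
  have *: "set_integrable \<mu> ((\<lambda>u. a * y + u) ` frac_ideal (n + 1)) f"
    "(LINT x:(\<lambda>u. a * y + u) ` frac_ideal (n + 1)|\<mu>. f x) = q powi (- (n + 1)) *\<^sub>R f (a * y)"
    if "y \<in> unit_reps" for y
    using set_integral_const[where f = f and c = "f (a * y)", OF _ _ const, of "(\<lambda>u. a * y + u) ` frac_ideal (n + 1)"] that
    by (simp_all add: emeasure_coset measure_coset open_coset)
  have "(LINT x:shell n|\<mu>. f x) = (\<Sum>y\<in>unit_reps. LINT x:(\<lambda>u. a * y + u) ` frac_ideal (n + 1)|\<mu>. f x)"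
    unfolding shell_eq_UN[OF a]
    using disjoint_unit_cosets[OF a] *(1)
    by (intro set_integral_finite_Union) (auto simp: finite_unit_reps emeasure_coset open_coset)
  also have "\<dots> = (\<Sum>y\<in>unit_reps. q powi (- (n + 1)) *\<^sub>R f (a * y))"
    using *(2) by (intro sum.cong) auto
  finally show ?thesis
    by (simp add: sum_distrib_left scaleR_conv_of_real)
qed

lemma set_integral_mult_haar:
  fixes f :: "'k \<Rightarrow> complex"
  shows "(LINT x:shell n|mult_haar \<mu>. f x) = of_real (q powi n) * (LINT x:shell n|\<mu>. f x)"
proof (cases "(\<lambda>x. indicator (shell n) x *\<^sub>R f x) \<in> borel_measurable borel")
  case True
  have "continuous_on UNIV (\<lambda>x::'k. dist x 0)"
    by (intro continuous_intros)
  then have "abs_val \<in> borel_measurable (borel :: 'k measure)"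
    by (intro borel_measurable_continuous_onI) (simp add: dist_abs_val)
  then have "(\<lambda>x::'k. inverse (abs_val x)) \<in> borel_measurable borel"
    by (rule borel_measurable_inverse)
  then have "(LINT x:shell n|mult_haar \<mu>. f x) =
      integral\<^sup>L \<mu> (\<lambda>x. inverse (abs_val x) *\<^sub>R (indicator (shell n) x *\<^sub>R f x))"
    unfolding set_lebesgue_integral_def mult_haar_def
    using True by (intro integral_density) (auto simp: abs_val_def)
  also have "(\<lambda>x. inverse (abs_val x) *\<^sub>R (indicator (shell n) x *\<^sub>R f x)) =
      (\<lambda>x. q powi n *\<^sub>R (indicator (shell n) x *\<^sub>R f x))"
    by (auto simp: indicator_def abs_val_shell q_def power_int_minus)
  finally show ?thesis
    by (simp add: set_lebesgue_integral_def scaleR_conv_of_real)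
next
  \<comment> \<open>Without measurability both integrals are 0 by convention, so the identity may be
    applied without examining the inner sum of the transform.\<close>
  case False
  let ?g = "\<lambda>x. indicator (shell n) x *\<^sub>R f x"
  have "borel_measurable (mult_haar \<mu>) = (borel_measurable borel :: ('k \<Rightarrow> complex) set)"
    by (rule measurable_cong_sets) (simp_all add: mult_haar_def)
  then have "\<not> integrable \<mu> ?g" "\<not> integrable (mult_haar \<mu>) ?g"
    using False borel_measurable_integrable[of \<mu> ?g] borel_measurable_integrable[of "mult_haar \<mu>" ?g]
    by auto
  then show ?thesis
    by (simp add: set_lebesgue_integral_def not_integrable_integral_eq)
qed

end

end

section \<open>Additive characters and Gaussian integrals\<close>

lemma additive_character_0: "additive_character \<Phi> \<Longrightarrow> \<Phi> 0 = 1"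
proof -
  assume \<Phi>: "additive_character \<Phi>"
  then have "\<Phi> (0 + 0) = \<Phi> 0 * \<Phi> 0" and "norm (\<Phi> 0) = 1"
    unfolding additive_character_def by blast+
  then show "\<Phi> 0 = 1"
    by auto
qed

text \<open>Factor \<open>z\<^sup>2 - 1\<close> and note that z + 1 differs from 2 by less than 1/2.
  This quantifies the absence of small subgroups in the unit circle.\<close>

lemma norm_square_minus_one_ge:
  fixes z :: complex
  assumes "norm (z - 1) < 1 / 2"
  shows "norm (z\<^sup>2 - 1) \<ge> 3 / 2 * norm (z - 1)"
proof -
  have "norm (z + 1) \<ge> 3 / 2"
    using norm_triangle_ineq4[of "z + 1" "z - 1"] assms by simp
  then have "3 / 2 * norm (z - 1) \<le> norm (z + 1) * norm (z - 1)"
    by (rule mult_right_mono) simp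
  also have "\<dots> = norm (z\<^sup>2 - 1)"
    by (simp add: norm_mult[symmetric] power2_eq_square algebra_simps)
  finally show ?thesis .
qed

text \<open>Repeated squaring moves every value other than \<open>1\<close> away from \<open>1\<close>.\<close>

lemma additive_character_trivial_nhd:
  fixes \<Phi> :: "'k::nonarch_local_field \<Rightarrow> complex"
  assumes \<Phi>: "additive_character \<Phi>"
  shows "\<exists>n. \<forall>x\<in>frac_ideal n. \<Phi> x = 1"
proof -
  let ?q = "real (residue_card TYPE('k))"
  have q: "?q > 1"
    using residue_card_gt_1[where 'k = 'k] by simp
  have "continuous_on UNIV \<Phi>"
    using \<Phi> by (simp add: additive_character_def)
  then obtain d where d: "d > 0" "\<And>x. dist x 0 < d \<Longrightarrow> norm (\<Phi> x - 1) < 1 / 2"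
    unfolding continuous_on_iff additive_character_0[OF \<Phi>, symmetric] dist_norm[symmetric]
    using half_gt_zero[OF zero_less_one] by blast
  obtain N where N: "inverse d < ?q ^ N"
    using real_arch_pow[OF q] by blast
  have small: "norm (\<Phi> x - 1) < 1 / 2" if "x \<in> frac_ideal (int N)" for x
  proof (rule d(2))
    have "dist x 0 \<le> inverse (?q ^ N)"
      using that diff_in_frac_ideal_iff[of x 0 "int N"] by (simp add: power_int_minus)
    also have "\<dots> < d"
      using N d(1) by (simp add: inverse_less_imp_less field_simps)
    finally show "dist x 0 < d" .
  qed
  have "\<Phi> x = 1" if x: "x \<in> frac_ideal (int N)" for x
  proof (rule ccontr)
    assume "\<Phi> x \<noteq> 1"
    then have pos: "norm (\<Phi> x - 1) > 0"
      by simp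
    have double: "2 ^ Suc k * x = 2 ^ k * x + 2 ^ k * x" for k :: nat
      by (metis mult.assoc mult_2 power_Suc)
    \<comment> \<open>Doubling does not leave the fractional ideal, so \<open>small\<close> bounds
      all values \<Phi>(\<open>2 ^ k * x\<close>), whereas their distance from 1 would grow
      geometrically.\<close>
    have mem: "2 ^ k * x \<in> frac_ideal (int N)" for k :: nat
    proof (induction k)
      case (Suc k)
      then show ?case
        using frac_ideal_add[OF Suc Suc] by (simp only: double)
    qed (use x in simp)
    have grow: "(3 / 2) ^ k * norm (\<Phi> x - 1) \<le> norm (\<Phi> (2 ^ k * x) - 1)" for k :: nat
    proof (induction k)
      case (Suc k)
      have "\<Phi> (2 ^ Suc k * x) = (\<Phi> (2 ^ k * x))\<^sup>2"
        using \<Phi> unfolding double power2_eq_square additive_character_def by blast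
      then show ?case
        using norm_square_minus_one_ge[OF small[OF mem[of k]]] Suc by simp
    qed simp
    obtain k :: nat where "1 / norm (\<Phi> x - 1) < (3 / 2) ^ k"
      using real_arch_pow[of "3 / 2"] by auto
    then have "1 < (3 / 2) ^ k * norm (\<Phi> x - 1)"
      using pos by (simp add: field_simps)
    then show False
      using grow[of k] small[OF mem[of k]] by linarith
  qed
  then show ?thesis
    by blast
qed

text \<open>A general c avoids rescaling \<Phi>: a phase of valuation at least c is invisible, and
  one of valuation exactly c - 1 is a nontrivial character of the residue field.\<close>

definition has_conductor :: "('k::valued_field \<Rightarrow> complex) \<Rightarrow> int \<Rightarrow> bool" where
  "has_conductor \<Phi> c \<longleftrightarrow>
    (\<forall>x\<in>frac_ideal c. \<Phi> x = 1) \<and> (\<exists>x\<in>frac_ideal (c - 1). \<Phi> x \<noteq> 1)"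

lemma additive_character_conductor:
  fixes \<Phi> :: "'k::nonarch_local_field \<Rightarrow> complex"
  assumes \<Phi>: "additive_character \<Phi>" and "\<exists>x. \<Phi> x \<noteq> 1"
  shows "\<exists>c. has_conductor \<Phi> c"
proof -
  obtain n where n: "\<forall>x\<in>frac_ideal n. \<Phi> x = 1"
    using additive_character_trivial_nhd[OF \<Phi>] by blast
  obtain x where x: "\<Phi> x \<noteq> 1"
    using assms(2) by blast
  \<comment> \<open>Here k counts downwards from the trivial level n, which makes the search
    well-founded; the least k with a nontrivial value gives c = n - (k - 1).\<close>
  let ?P = "\<lambda>k. \<exists>y\<in>frac_ideal (n - int k). \<Phi> y \<noteq> 1"
  have "?P (nat (n - ord x))"
    using x by (intro bexI[of _ x]) (auto simp: frac_ideal_def)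
  then obtain k where k: "?P k" "\<And>i. i < k \<Longrightarrow> \<not> ?P i"
    using ex_least_nat_le[of ?P] by blast
  moreover have "k \<noteq> 0"
    using k(1) n by (metis diff_zero of_nat_0)
  moreover have "\<forall>y\<in>frac_ideal (n - int (k - 1)). \<Phi> y = 1"
    using k(2)[of "k - 1"] \<open>k \<noteq> 0\<close> by simp
  moreover have "n - int (k - 1) - 1 = n - int k"
    using \<open>k \<noteq> 0\<close> by simp
  ultimately show ?thesis
    unfolding has_conductor_def by (intro exI[of _ "n - int (k - 1)"]) (simp only: simp_thms)
qed

text \<open>The improper integral of the quadratic phase over k. The phase has absolute value 1 and
  is not integrable on k, hence the sum over shells, as in \<open>mock_fourier\<close>; the omitted
  point 0 has measure 0.\<close>

definition gauss_integral ::
    "('k::nonarch_local_field \<Rightarrow> complex) \<Rightarrow> 'k measure \<Rightarrow> 'k \<Rightarrow> complex" where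
  "gauss_integral \<Phi> \<mu> \<gamma> = (\<Sum>\<^sub>\<infinity>l\<in>(UNIV :: int set). LINT t:shell l|\<mu>. \<Phi> (\<gamma> * t\<^sup>2))"

context
  fixes \<Phi> :: "'k::nonarch_local_field \<Rightarrow> complex" and c :: int
  assumes \<Phi>: "additive_character \<Phi>" and cond: "has_conductor \<Phi> c"
begin

lemma character_trivial: "x \<in> frac_ideal c \<Longrightarrow> \<Phi> x = 1"
  using cond by (simp add: has_conductor_def)

lemma character_nontrivial: "\<exists>x\<in>frac_ideal (c - 1). \<Phi> x \<noteq> 1"
  using cond by (simp add: has_conductor_def)

lemma character_add: "\<Phi> (x + y) = \<Phi> x * \<Phi> y"
  using \<Phi> by (simp add: additive_character_def)

lemma character_cong: "x - y \<in> frac_ideal c \<Longrightarrow> \<Phi> x = \<Phi> y"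
  using character_add[of "x - y" y] character_trivial by simp

text \<open>Choose y with \<Phi>(d y) different from 1. Shifting w by y permutes the residues and
  multiplies the sum by \<Phi>(d y).\<close>

lemma sum_character:
  assumes d: "d \<in> shell (c - 1)"
  shows "(\<Sum>w\<in>residue_reps. \<Phi> (d * w)) = 0"
proof -
  obtain z where z: "z \<in> frac_ideal (c - 1)" "\<Phi> z \<noteq> 1"
    using character_nontrivial by blast
  define y where "y = z / d"
  have y: "y \<in> frac_ideal 0" and z_eq: "z = d * y"
    using frac_ideal_divide_shell[OF z(1) d, of 0] shell_nonzero[OF d] by (auto simp: y_def)
  let ?g = "\<lambda>w. residue_rep (w + y)"
  have wy: "w + y \<in> frac_ideal 0" if "w \<in> residue_reps" for w
    using frac_ideal_add[OF _ y] residue_reps_subset that by blast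
  have inj: "inj_on ?g residue_reps"
  proof (rule inj_onI)
    fix v w
    assume vw: "v \<in> residue_reps" "w \<in> residue_reps" "?g v = ?g w"
    then have "v + y - (w + y) \<in> frac_ideal 1"
      using residue_rep_cong[OF wy wy] by blast
    then show "v = w"
      using vw by (intro residue_reps_eqI) simp_all
  qed
  moreover have "?g ` residue_reps \<subseteq> residue_reps"
    using residue_rep(1)[OF wy] by blast
  ultimately have "bij_betw ?g residue_reps residue_reps"
    using finite_residue_reps endo_inj_surj by (simp add: bij_betw_def endo_inj_surj)
  then have "(\<Sum>w\<in>residue_reps. \<Phi> (d * w)) = (\<Sum>w\<in>residue_reps. \<Phi> (d * ?g w))"
    by (rule sum.reindex_bij_betw[symmetric])
  also have "\<dots> = (\<Sum>w\<in>residue_reps. \<Phi> z * \<Phi> (d * w))"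
  proof (rule sum.cong)
    fix w :: 'k
    assume w: "w \<in> residue_reps"
    have "d * (w + y - ?g w) \<in> frac_ideal (c - 1 + 1)"
      by (rule frac_ideal_mult[OF shell_subset[OF d order_refl] residue_rep(2)[OF wy[OF w]]])
    then have "\<Phi> (d * (w + y)) = \<Phi> (d * ?g w)"
      by (intro character_cong) (simp add: algebra_simps)
    then show "\<Phi> (d * ?g w) = \<Phi> z * \<Phi> (d * w)"
      by (simp add: character_add[symmetric] z_eq algebra_simps)
  qed simp
  finally have "(1 - \<Phi> z) * (\<Sum>w\<in>residue_reps. \<Phi> (d * w)) = 0"
    by (simp add: sum_distrib_left[symmetric] algebra_simps)
  then show ?thesis
    using z by simp
qed

section \<open>Cancellation on shells and the Gaussian integral\<close>

context
  fixes \<mu> :: "'k measure"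
  assumes haar: "normalised_haar \<mu>" and two: "(2 :: 'k) \<notin> max_ideal"
begin

text \<open>Averaging over translates turns the integral into a complete character sum on \<open>\<O>/\<pp>\<close>.\<close>

lemma set_integral_shell_vanish:
  fixes f :: "'k \<Rightarrow> complex"
  assumes b: "b \<in> shell k" and k: "k > n"
    and f: "\<And>t. t \<in> shell n \<Longrightarrow>
      \<exists>C. \<exists>d\<in>shell (c - 1). \<forall>w\<in>frac_ideal 0. f (t + b * w) = C * \<Phi> (d * w)"
  shows "(LINT t:shell n|\<mu>. f t) = 0"
proof (rule set_integral_vanish[OF haar, where T = "(*) b ` residue_reps"])
  show "finite ((*) b ` residue_reps)"
    by (simp add: finite_residue_reps)
  show "(*) b ` residue_reps \<noteq> {}"
    using residue_rep(1)[of "0::'k"] by auto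
next
  fix t u :: 'k
  assume "u \<in> (*) b ` residue_reps"
  then have "u \<in> frac_ideal (n + 1)"
    using residue_reps_subset shell_subset[OF b order_refl] k
    by (auto intro: frac_ideal_mult'[of b k _ 0])
  then show "t + u \<in> shell n \<longleftrightarrow> t \<in> shell n"
    using shell_add[of t n u] shell_add[of "t + u" n "- u"] by auto
next
  fix t :: 'k
  assume "t \<in> shell n"
  then obtain C d where d: "d \<in> shell (c - 1)"
    and f: "\<And>w. w \<in> frac_ideal 0 \<Longrightarrow> f (t + b * w) = C * \<Phi> (d * w)"
    using f by blast
  have "inj_on ((*) b) residue_reps"
    using shell_nonzero[OF b] by (auto simp: inj_on_def)
  then have "(\<Sum>u\<in>(*) b ` residue_reps. f (t + u)) = (\<Sum>w\<in>residue_reps. f (t + b * w))"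
    by (simp add: sum.reindex)
  also have "\<dots> = (\<Sum>w\<in>residue_reps. C * \<Phi> (d * w))"
    using f residue_reps_subset by (intro sum.cong) auto
  also have "\<dots> = 0"
    using sum_character[OF d] by (simp add: sum_distrib_left[symmetric])
  finally show "(\<Sum>u\<in>(*) b ` residue_reps. f (t + u)) = 0" .
qed

text \<open>The bound stops just short of m + 2l = c - 1, where a finite Gauss sum would remain;
  from m + 2l = c on the phase is trivial.\<close>

lemma gauss_shell_vanish:
  assumes \<gamma>: "\<gamma> \<in> shell m" and l: "m + 2 * l \<le> c - 2"
  shows "(LINT t:shell l|\<mu>. \<Phi> (\<gamma> * t\<^sup>2)) = 0"
proof -
  \<comment> \<open>This k gives the linear term \<open>2 * \<gamma> * t * b\<close> valuation
    exactly c - 1. The quadratic term then has valuation at least 2c - 2 - (m + 2l) \<ge> c and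
    disappears.\<close>
  define k where "k = c - 1 - m - l"
  obtain b :: 'k where b: "b \<in> shell k"
    using shell_nonempty by blast
  show ?thesis
  proof (rule set_integral_shell_vanish[OF b])
    show "k > l"
      using l by (simp add: k_def)
  next
    fix t :: 'k
    assume t: "t \<in> shell l"
    have "2 * \<gamma> * t * b \<in> shell (0 + m + l + k)"
      by (intro shell_mult shell_two two \<gamma> t b)
    then have d: "2 * \<gamma> * t * b \<in> shell (c - 1)"
      by (simp add: k_def)
    have "\<Phi> (\<gamma> * (t + b * w)\<^sup>2) = \<Phi> (\<gamma> * t\<^sup>2) * \<Phi> (2 * \<gamma> * t * b * w)" if w: "w \<in> frac_ideal 0" for w
    proof -
      have "(b * w)\<^sup>2 \<in> frac_ideal (2 * k)"
        by (rule frac_ideal_square[OF frac_ideal_mult'[OF shell_subset[OF b order_refl] w]]) auto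
      then have "\<gamma> * (b * w)\<^sup>2 \<in> frac_ideal c"
        using l by (intro frac_ideal_mult'[OF shell_subset[OF \<gamma> order_refl]]) (auto simp: k_def)
      moreover have "\<gamma> * (t + b * w)\<^sup>2 - (\<gamma> * t\<^sup>2 + 2 * \<gamma> * t * b * w) = \<gamma> * (b * w)\<^sup>2"
        by (simp add: power2_eq_square algebra_simps)
      ultimately have "\<Phi> (\<gamma> * (t + b * w)\<^sup>2) = \<Phi> (\<gamma> * t\<^sup>2 + 2 * \<gamma> * t * b * w)"
        by (intro character_cong) simp
      then show ?thesis
        by (simp only: character_add)
    qed
    with d show "\<exists>C. \<exists>d\<in>shell (c - 1). \<forall>w\<in>frac_ideal 0. \<Phi> (\<gamma> * (t + b * w)\<^sup>2) = C * \<Phi> (d * w)"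
      by blast
  qed
qed

text \<open>Shell by shell: either both integrals vanish by oscillation, or
  \<open>\<delta> * t\<^sup>2\<close> has valuation at least m + 1 + 2l \<ge> c and does not change
  the phase.\<close>

lemma gauss_integral_cong:
  assumes \<gamma>: "\<gamma> \<in> shell m" and \<delta>: "\<delta> \<in> frac_ideal (m + 1)"
  shows "gauss_integral \<Phi> \<mu> (\<gamma> + \<delta>) = gauss_integral \<Phi> \<mu> \<gamma>"
  unfolding gauss_integral_def
proof (rule infsum_cong)
  fix l :: int
  show "(LINT t:shell l|\<mu>. \<Phi> ((\<gamma> + \<delta>) * t\<^sup>2)) = (LINT t:shell l|\<mu>. \<Phi> (\<gamma> * t\<^sup>2))"
  proof (cases "m + 2 * l \<le> c - 2")
    case True
    then show ?thesis
      using gauss_shell_vanish[OF \<gamma>] gauss_shell_vanish[OF shell_add[OF \<gamma> \<delta>]] by simp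
  next
    case False
    have "\<Phi> ((\<gamma> + \<delta>) * t\<^sup>2) = \<Phi> (\<gamma> * t\<^sup>2)" if t: "t \<in> shell l" for t
    proof (rule character_cong)
      have "\<delta> * t\<^sup>2 \<in> frac_ideal c"
        using False
        by (intro frac_ideal_mult'[OF \<delta> frac_ideal_square[OF shell_subset[OF t order_refl] order_refl]]) auto
      then show "(\<gamma> + \<delta>) * t\<^sup>2 - \<gamma> * t\<^sup>2 \<in> frac_ideal c"
        by (simp add: algebra_simps)
    qed
    then show ?thesis
      by (intro set_lebesgue_integral_cong) (auto simp: open_shell haar sets_haar[OF haar])
  qed
qed

text \<open>For m = c - 2 parity excludes the Gauss sum level c - 1. Shells with l \<le> 0 cancel
  and on those with l \<ge> 1 the phase is 1, so the value is the volume 1/q of the maximal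
  ideal.\<close>

lemma gauss_integral_eq:
  assumes q_def: "q = real (residue_card TYPE('k))" and \<gamma>: "\<gamma> \<in> shell (c - 2)"
  shows "gauss_integral \<Phi> \<mu> \<gamma> = of_real (inverse q)"
proof -
  note q = q_gt_1[OF q_def]
  let ?f = "\<lambda>l. LINT t:shell l|\<mu>. \<Phi> (\<gamma> * t\<^sup>2)"
  have neg: "?f l = 0" if "l < 1" for l
    using that by (intro gauss_shell_vanish[OF \<gamma>]) simp
  have pos: "?f (int n + 1) = of_real (inverse q ^ (n + 1) - inverse q ^ (Suc n + 1))" for n
  proof -
    have "\<Phi> (\<gamma> * t\<^sup>2) = 1" if t: "t \<in> shell (int n + 1)" for t
      by (intro character_trivial frac_ideal_mult'[OF shell_subset[OF \<gamma> order_refl]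
            frac_ideal_square[OF shell_subset[OF t order_refl] order_refl]]) simp
    moreover have "emeasure \<mu> (shell (int n + 1)) \<le> emeasure \<mu> (frac_ideal (int n + 1))"
      by (intro emeasure_mono) (auto simp: shell_subset open_frac_ideal sets_haar[OF haar])
    then have "emeasure \<mu> (shell (int n + 1)) < \<infinity>"
      by (simp add: emeasure_frac_ideal[OF haar q_def] order_le_less_trans)
    ultimately have "?f (int n + 1) = measure \<mu> (shell (int n + 1)) *\<^sub>R 1"
      by (intro set_integral_const[OF haar]) (auto simp: open_shell)
    also have "measure \<mu> (shell (int n + 1)) = inverse q ^ (n + 1) - inverse q ^ (Suc n + 1)"
    proof -
      have "q powi (- (int k)) = inverse q ^ k" for k
        by (simp add: power_int_minus power_inverse)
      from this[of "n + 1"] this[of "n + 2"] show ?thesis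
        by (simp add: measure_shell[OF haar q_def] algebra_simps)
    qed
    finally show ?thesis
      by (simp add: scaleR_conv_of_real)
  qed
  have "(\<lambda>n. inverse q ^ (n + 1) - inverse q ^ (Suc n + 1)) sums (inverse q ^ (0 + 1) - 0)"
    using q by (intro telescope_sums' LIMSEQ_ignore_initial_segment LIMSEQ_realpow_zero)
      (auto simp: inverse_less_1_iff)
  moreover have "inverse q ^ (Suc n + 1) \<le> inverse q ^ (n + 1)" for n
    using q by (intro power_decreasing) (auto simp: inverse_le_1_iff)
  \<comment> \<open>Nonnegativity of the terms turns the telescoping series into an unconditional
    sum, as \<open>infsum\<close> requires.\<close>
  ultimately have "((\<lambda>n. inverse q ^ (n + 1) - inverse q ^ (Suc n + 1)) has_sum inverse q) UNIV"
    by (intro sums_nonneg_imp_has_sum) auto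
  then have "((\<lambda>n. ?f (int n + 1)) has_sum of_real (inverse q)) UNIV"
    unfolding pos by (rule has_sum_of_real)
  then have "(\<Sum>\<^sub>\<infinity>n. ?f (int n + 1)) = of_real (inverse q)"
    by (rule infsumI)
  moreover have "bij_betw (\<lambda>n. int n + 1) UNIV {1..}"
    by (intro bij_betwI[of _ _ _ "\<lambda>l. nat (l - 1)"]) auto
  ultimately have "infsum ?f {1..} = of_real (inverse q)"
    using infsum_reindex_bij_betw[of "\<lambda>n. int n + 1" UNIV "{1..}" ?f] by simp
  moreover have "infsum ?f {1..} = infsum ?f UNIV"
    by (intro infsum_cong_neutral) (auto simp: neg)
  ultimately show ?thesis
    by (simp add: gauss_integral_def)
qed

end

end

section \<open>A quadratic substitution\<close>

text \<open>Solving \<open>\<epsilon>y + y\<^sup>-\<^sup>1 = 2w\<close> for \<open>y\<close> leads to the discriminant \<open>w\<^sup>2 - \<epsilon>\<close>. When this is a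
  square the two solutions have product \<open>\<epsilon>\<^sup>-\<^sup>1\<close>, so exactly one of them is a square.\<close>

lemma sum_quadratic_substitution:
  fixes \<epsilon> :: "'k::nonarch_local_field" and f :: "'k \<Rightarrow> complex"
  assumes two: "(2 :: 'k) \<notin> max_ideal"
    and \<epsilon>: "\<epsilon> \<in> shell 0" "\<not> is_square \<epsilon>"
    and f: "\<And>x y. x \<in> frac_ideal 0 \<Longrightarrow> x - y \<in> frac_ideal 1 \<Longrightarrow> f x = f y"
  shows "(\<Sum>y | y \<in> unit_reps \<and> is_square y. f ((\<epsilon> * y + inverse y) / 2)) =
    (\<Sum>w | w \<in> residue_reps \<and> is_square (w\<^sup>2 - \<epsilon>). f w)"
proof -
  let ?\<phi> = "\<lambda>y. (\<epsilon> * y + inverse y) / 2"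
  let ?g = "\<lambda>y. residue_rep (?\<phi> y)"
  let ?U = "{y. y \<in> unit_reps \<and> is_square y}"
  let ?W = "{w. w \<in> residue_reps \<and> is_square (w\<^sup>2 - \<epsilon>)}"
  note two' = shell_two[OF two]
  have \<epsilon>0: "\<epsilon> \<noteq> 0" and two0: "(2::'k) \<noteq> 0"
    using shell_nonzero[OF \<epsilon>(1)] shell_nonzero[OF two'] by auto
  have \<phi>0: "?\<phi> y \<in> frac_ideal 0" if y: "y \<in> shell 0" for y
  proof (rule frac_ideal_divide_shell[OF frac_ideal_add two'])
    show "\<epsilon> * y \<in> frac_ideal 0" "inverse y \<in> frac_ideal 0"
      using shell_subset[OF shell_mult[OF \<epsilon>(1) y]] shell_subset[OF shell_inverse[OF y]] by auto
  qed simp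
  \<comment> \<open>Used twice: for injectivity the last factor is a unit, while for surjectivity
    its integrality makes congruent y have congruent images.\<close>
  have \<phi>_diff: "?\<phi> y - ?\<phi> z = (y - z) * ((\<epsilon> - inverse (y * z)) / 2)"
    if "y \<noteq> 0" "z \<noteq> 0" for y z
  proof -
    have "(y - z) * inverse (y * z) = inverse z - inverse y"
      using that by (simp add: field_simps)
    then have "(y - z) * (\<epsilon> - inverse (y * z)) = (\<epsilon> * y + inverse y) - (\<epsilon> * z + inverse z)"
      by (simp add: algebra_simps)
    then show ?thesis
      by (simp add: diff_divide_distrib[symmetric])
  qed
  note unit = square_diff_nonsquare_unit[OF two _ \<epsilon>]
  have fg: "f (?\<phi> y) = f (?g y)" if "y \<in> shell 0" for y
    using f[OF \<phi>0 residue_rep(2)[OF \<phi>0]] that by blast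
  have "bij_betw ?g ?U ?W"
  proof (rule bij_betw_imageI)
    show "inj_on ?g ?U"
    proof (rule inj_onI)
      fix y z
      assume yz: "y \<in> ?U" "z \<in> ?U" "?g y = ?g z"
      then have sh: "y \<in> shell 0" "z \<in> shell 0"
        by (auto simp: unit_reps_def)
      then have *: "(y - z) * ((\<epsilon> - inverse (y * z)) / 2) \<in> frac_ideal 1"
        using residue_rep_cong[OF \<phi>0 \<phi>0] yz(3) \<phi>_diff shell_nonzero by metis
      obtain v w where vw: "y = v\<^sup>2" "z = w\<^sup>2"
        using yz by (auto simp: is_square_def)
      then have "inverse (y * z) = (inverse (v * w))\<^sup>2"
        by (simp add: power_mult_distrib power_inverse)
      \<comment> \<open>A square cannot be congruent to the nonsquare unit \<epsilon>. On all units
        injectivity would fail, since y and 1/(\<epsilon> y) have the same image.\<close>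
      then have "inverse (y * z) - \<epsilon> \<notin> frac_ideal 1"
        using is_square_cong_diff[OF two \<epsilon>(1), of "inverse (y * z)"] \<epsilon>(2) by auto
      moreover have "inverse (y * z) \<in> shell 0"
        using shell_inverse[OF shell_mult[OF sh]] by simp
      then have "\<epsilon> - inverse (y * z) \<in> frac_ideal 0"
        using \<epsilon>(1) by (simp add: frac_ideal_diff shell_subset)
      ultimately have "\<epsilon> - inverse (y * z) \<in> shell 0"
        by (simp add: shell_eq frac_ideal_diff_commute)
      then have "(\<epsilon> - inverse (y * z)) / 2 \<in> shell 0"
        using shell_divide[OF _ two'] by fastforce
      from frac_ideal_divide_shell[OF * this, of 1] shell_nonzero[OF this]
      have "y - z \<in> frac_ideal 1"
        by simp
      then show "y = z"
        using yz by (intro residue_reps_eqI) (auto simp: unit_reps_def)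
    qed
    have "?g y \<in> ?W" if y: "y \<in> ?U" for y
    proof -
      have sh: "y \<in> shell 0"
        using y by (auto simp: unit_reps_def)
      \<comment> \<open>As \<open>\<epsilon> * y\<close> and \<open>inverse y\<close> have product
        \<epsilon>, the square of their half-sum minus \<epsilon> is the square of their
        half-difference.\<close>
      have "(?\<phi> y)\<^sup>2 - \<epsilon> = ((\<epsilon> * y - inverse y) / 2)\<^sup>2"
      proof -
        have "(\<epsilon> * y + inverse y)\<^sup>2 = (\<epsilon> * y - inverse y)\<^sup>2 + 2\<^sup>2 * ((\<epsilon> * y) * inverse y)"
          by algebra
        also have "(\<epsilon> * y) * inverse y = \<epsilon>"
          using shell_nonzero[OF sh] by simp
        finally show ?thesis
          using power_not_zero[OF two0, of 2] unfolding power_divide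
          by (simp add: add_divide_distrib)
      qed
      then have "is_square ((?\<phi> y)\<^sup>2 - \<epsilon>)"
        by simp
      moreover have "(?g y - ?\<phi> y) * (?g y + ?\<phi> y) \<in> frac_ideal (1 + 0)"
        using residue_rep[OF \<phi>0[OF sh]] \<phi>0[OF sh] residue_reps_subset
        by (intro frac_ideal_mult frac_ideal_add) (auto simp: frac_ideal_diff_commute)
      then have "((?g y)\<^sup>2 - \<epsilon>) - ((?\<phi> y)\<^sup>2 - \<epsilon>) \<in> frac_ideal (0 + 1)"
        by (simp add: power2_eq_square algebra_simps)
      ultimately have "is_square ((?g y)\<^sup>2 - \<epsilon>)"
        using is_square_cong_diff[OF two unit[OF \<phi>0[OF sh]]] by blast
      then show ?thesis
        using residue_rep(1)[OF \<phi>0[OF sh]] by blast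
    qed
    moreover have "w \<in> ?g ` ?U" if w: "w \<in> ?W" for w
    proof -
      have w0: "w \<in> frac_ideal 0"
        using w residue_reps_subset by blast
      obtain d where d: "w\<^sup>2 - \<epsilon> = d\<^sup>2"
        using w by (auto simp: is_square_def)
      then have "d\<^sup>2 \<in> shell 0"
        using unit[OF w0] by simp
      then have d0: "d \<in> frac_ideal 0"
        by (auto simp: shell_def frac_ideal_def ord_power)
      \<comment> \<open>These are the roots of
        \<open>\<epsilon> * y\<^sup>2 - 2 * w * y + 1\<close>. Both are integral and their product
        is the unit \<open>inverse \<epsilon>\<close>, so both are units.\<close>
      let ?y = "(w + d) / \<epsilon>" and ?z = "(w - d) / \<epsilon>"
      have "(w + d) * (w - d) = \<epsilon>"
        using d by (simp add: power2_eq_square algebra_simps)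
      then have prod: "?y * ?z = inverse \<epsilon>"
        using \<epsilon>0 by (simp add: field_simps)
      have "?y \<in> frac_ideal 0" "?z \<in> frac_ideal 0"
        using frac_ideal_divide_shell[OF _ \<epsilon>(1), of _ 0 0] frac_ideal_add[OF w0 d0] frac_ideal_diff[OF w0 d0]
        by auto
      moreover have nz: "?y \<noteq> 0" "?z \<noteq> 0"
        using prod \<epsilon>0 by (metis inverse_nonzero_iff_nonzero mult_zero_left mult_zero_right)+
      moreover have "ord ?y + ord ?z = 0"
        using ord_mult[OF nz] prod shell_inverse[OF \<epsilon>(1)] by (simp add: shell_def)
      ultimately have yz: "?y \<in> shell 0" "?z \<in> shell 0"
        unfolding frac_ideal_def shell_def by auto
      have "\<not> is_square (inverse \<epsilon>)"
        using \<epsilon>(2) by (metis inverse_inverse_eq is_square_def power_inverse)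
      \<comment> \<open>Two nonsquare units would have a square product. Surjectivity needs only one
        square root of the equation; that there is no second one is the injectivity above.\<close>
      then have "is_square ?y \<or> is_square ?z"
        using nonsquare_mult_nonsquare[OF two yz(1) _ yz(2)] prod by metis
      moreover have "?\<phi> ?y = w" "?\<phi> ?z = w"
      proof -
        have "inverse ?y = \<epsilon> * ?z" "inverse ?z = \<epsilon> * ?y"
          using prod \<epsilon>0 nz by (simp_all add: field_simps)
        then show "?\<phi> ?y = w" "?\<phi> ?z = w"
          using \<epsilon>0 two0 by (simp_all add: field_simps)
      qed
      ultimately obtain y where y: "y \<in> shell 0" "is_square y" "?\<phi> y = w"
        using yz by blast
      \<comment> \<open>The solution y need not be a chosen representative. Replacing it by one
        moves the image only within the class of w, and w itself is a representative.\<close>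
      let ?r = "residue_rep y"
      have r: "?r \<in> ?U" "?r \<in> shell 0" "?r - y \<in> frac_ideal 1"
        using residue_rep_in_unit_reps[OF y(1)] is_square_residue_rep[OF two y(1)] y(2)
          residue_rep(2)[OF shell_subset[OF y(1) order_refl]] residue_rep_unit[OF y(1)]
        by (auto simp: frac_ideal_diff_commute)
      have "(\<epsilon> - inverse (?r * y)) / 2 \<in> frac_ideal 0"
        using shell_inverse[OF shell_mult[OF r(2) y(1)]] \<epsilon>(1)
        by (intro frac_ideal_divide_shell[OF frac_ideal_diff two', of _ 0]) (auto simp: shell_subset)
      then have "(?r - y) * ((\<epsilon> - inverse (?r * y)) / 2) \<in> frac_ideal 1"
        by (rule frac_ideal_mult'[OF r(3)]) simp
      then have "?\<phi> ?r - w \<in> frac_ideal 1"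
        unfolding \<phi>_diff[OF shell_nonzero[OF r(2)] shell_nonzero[OF y(1)], symmetric] y(3) .
      then have "?g ?r = w"
        using w by (intro residue_rep_eqI) auto
      then show ?thesis
        using r(1) by blast
    qed
    ultimately show "?g ` ?U = ?W"
      by blast
  qed
  then have "(\<Sum>y\<in>?U. f (?g y)) = (\<Sum>w\<in>?W. f w)"
    by (rule sum.reindex_bij_betw)
  moreover have "(\<Sum>y\<in>?U. f (?\<phi> y)) = (\<Sum>y\<in>?U. f (?g y))"
    using fg by (intro sum.cong) (auto simp: unit_reps_def)
  ultimately show ?thesis
    by simp
qed

section \<open>Tori\<close>

abbreviation (input) torus_elem :: "'k::field \<Rightarrow> 'k \<Rightarrow> 'k^2^2" where
  "torus_elem \<theta> c \<equiv> smult_mat c (sqrt_mat \<theta>)"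

lemma torus_elem_nth [simp]:
  "torus_elem \<theta> c $ 1 $ 1 = 0" "torus_elem \<theta> c $ 1 $ 2 = c"
  "torus_elem \<theta> c $ 2 $ 1 = c * \<theta>" "torus_elem \<theta> c $ 2 $ 2 = 0"
  by (simp_all add: smult_mat_def sqrt_mat_def)

lemma torus_elem_eq_iff [simp]: "torus_elem \<theta> c = torus_elem \<theta> d \<longleftrightarrow> c = d"
  by (metis torus_elem_nth(2))

lemma torus_elem_eq_0_iff [simp]: "torus_elem \<theta> c = 0 \<longleftrightarrow> c = 0"
  by (auto simp: vec_eq_iff forall_2)

lemma torus_elem_diff: "torus_elem \<theta> c - torus_elem \<theta> d = torus_elem \<theta> (c - d)"
  by (simp add: vec_eq_iff forall_2 algebra_simps)

lemma trace_functional_torus_elem: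
  "trace_functional (torus_elem \<theta> \<beta>) (torus_elem \<theta> c) = 2 * \<beta> * c * \<theta>"
  by (simp add: trace_functional_def trace_def sum_2 matrix_matrix_mult_def algebra_simps)

lemma scalar_of_torus_elem_square: "scalar_of_mat (torus_elem \<theta> c ** torus_elem \<theta> c) = c\<^sup>2 * \<theta>"
proof -
  have "torus_elem \<theta> c ** torus_elem \<theta> c = mat (c\<^sup>2 * \<theta>)"
    by (simp add: vec_eq_iff forall_2 matrix_matrix_mult_def sum_2 mat_def power2_eq_square)
  moreover have "mat x = (mat y :: 'a^2^2) \<Longrightarrow> x = y" for x y
    by (simp add: vec_eq_iff mat_def) metis
  ultimately show ?thesis
    unfolding scalar_of_mat_def by (intro the_equality) auto
qed

lemma disc_g_torus_elem: "disc_g (torus_elem \<theta> c) = 4 * (c\<^sup>2 * \<theta>)"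
  by (simp add: disc_g_def power2_eq_square algebra_simps)

lemma depth_torus_elem:
  assumes "\<theta> \<noteq> 0"
  shows "depth \<theta> (torus_elem \<theta> c) = (if c = 0 then \<infinity> else ereal (of_int (2 * ord c + ord \<theta>) / 2))"
  using assms by (simp add: depth_def ord_mult ord_power)

lemma depth_torus_elem_uniformiser:
  assumes "uniformiser \<pi>"
  shows "depth \<pi> (torus_elem \<pi> c) = (if c = 0 then \<infinity> else ereal (of_int (ord c) + 1 / 2))"
  using assms depth_torus_elem[of \<pi> c] by (auto simp: uniformiser_def field_simps)

text \<open>Depths on the ramified Lie algebra are half-odd, \<open>ord c + 1 / 2\<close>, so the
  depth filtration at such a value is the filtration of k by fractional ideals, and the strict
  version is one ideal deeper.\<close>

lemma torus_ge_eq: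
  assumes "uniformiser \<pi>"
  shows "torus_ge \<pi> (of_int m + 1 / 2) = torus_elem \<pi> ` frac_ideal m"
  using depth_torus_elem_uniformiser[OF assms]
  by (auto simp: torus_ge_def torus_lie_def frac_ideal_def split: if_splits)

lemma torus_gt_eq:
  assumes "uniformiser \<pi>"
  shows "torus_gt \<pi> (of_int m + 1 / 2) = torus_elem \<pi> ` frac_ideal (m + 1)"
  using depth_torus_elem_uniformiser[OF assms]
  by (auto simp: torus_gt_def torus_lie_def frac_ideal_def split: if_splits)

text \<open>The invariance of F makes the value at the element picked by \<open>SOME\<close>
  independent of the choice; multiplication by a identifies the residue field with the
  quotient.\<close>

lemma sum_torus_quotient:
  fixes \<pi> :: "'k::nonarch_local_field" and F :: "'k^2^2 \<Rightarrow> complex"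
  assumes \<pi>: "uniformiser \<pi>" and a: "a \<in> shell m" and r: "r = of_int m + 1 / 2"
    and F: "\<And>z u. z \<in> frac_ideal m \<Longrightarrow> u \<in> frac_ideal (m + 1) \<Longrightarrow>
      F (torus_elem \<pi> (z + u)) = F (torus_elem \<pi> z)"
  shows "(\<Sum>C\<in>torus_quotient \<pi> r. F (SOME Z. Z \<in> C)) = (\<Sum>w\<in>residue_reps. F (torus_elem \<pi> (a * w)))"
proof -
  let ?T = "torus_elem \<pi>"
  define R where "R = {(Z, W). Z \<in> torus_ge \<pi> r \<and> W \<in> torus_ge \<pi> r \<and> Z - W \<in> torus_gt \<pi> r}"
  have R_iff: "(?T z, ?T w) \<in> R \<longleftrightarrow> z \<in> frac_ideal m \<and> w \<in> frac_ideal m \<and> z - w \<in> frac_ideal (m + 1)"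
    for z w
    using torus_ge_eq[OF \<pi>, of m] torus_gt_eq[OF \<pi>, of m]
    by (auto simp: R_def r torus_elem_diff)
  have ge: "torus_ge \<pi> r = ?T ` frac_ideal m"
    using torus_ge_eq[OF \<pi>] by (simp add: r)
  have tq: "torus_quotient \<pi> r = torus_ge \<pi> r // R"
    by (simp add: torus_quotient_def R_def)
  have R_sub: "R \<subseteq> torus_ge \<pi> r \<times> torus_ge \<pi> r"
    by (auto simp: R_def)
  have equiv: "equiv (torus_ge \<pi> r) R"
  proof (rule equivI)
    show "refl_on (torus_ge \<pi> r) R"
      unfolding refl_on_def ge using R_iff by fastforce
    show "sym R"
    proof (rule symI)
      fix Z W assume "(Z, W) \<in> R"
      then obtain z w where "Z = ?T z" "W = ?T w"
        using R_sub unfolding ge by blast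
      with \<open>(Z, W) \<in> R\<close> show "(W, Z) \<in> R"
        using R_iff frac_ideal_diff_commute by blast
    qed
    show "trans R"
    proof (rule transI)
      fix Z W V assume *: "(Z, W) \<in> R" "(W, V) \<in> R"
      then obtain z w v where zwv: "Z = ?T z" "W = ?T w" "V = ?T v"
        using R_sub unfolding ge by blast
      then have "(z - w) + (w - v) \<in> frac_ideal (m + 1)"
        using * R_iff frac_ideal_add by blast
      moreover have "z \<in> frac_ideal m" "v \<in> frac_ideal m"
        using * R_iff zwv by blast+
      ultimately show "(Z, V) \<in> R"
        unfolding zwv R_iff by simp
    qed
  qed (rule R_sub)
  have aw: "a * w \<in> frac_ideal m" if "w \<in> residue_reps" for w
    using frac_ideal_mult'[OF shell_subset[OF a order_refl], of w 0 m] residue_reps_subset that by auto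
  have bij: "bij_betw (\<lambda>w. R `` {?T (a * w)}) residue_reps (torus_quotient \<pi> r)"
  proof (rule bij_betw_imageI)
    show "inj_on (\<lambda>w. R `` {?T (a * w)}) residue_reps"
    proof (rule inj_onI)
      fix v w
      assume vw: "v \<in> residue_reps" "w \<in> residue_reps" "R `` {?T (a * v)} = R `` {?T (a * w)}"
      then have "(?T (a * v), ?T (a * w)) \<in> R"
        using aw by (intro eq_equiv_class[OF _ equiv]) (auto simp: ge)
      then have "(a * v - a * w) / a \<in> frac_ideal 1"
        using R_iff frac_ideal_divide_shell[OF _ a, of _ "m + 1" 1] by simp
      then show "v = w"
        using vw shell_nonzero[OF a] by (intro residue_reps_eqI) (auto simp: diff_divide_distrib)
    qed
    have "R `` {?T z} \<in> (\<lambda>w. R `` {?T (a * w)}) ` residue_reps" if z: "z \<in> frac_ideal m" for z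
    proof -
      let ?w = "residue_rep (z / a)"
      have za: "z / a \<in> frac_ideal 0"
        using frac_ideal_divide_shell[OF z a] by simp
      have "a * (z / a - ?w) \<in> frac_ideal (m + 1)"
        by (rule frac_ideal_mult[OF shell_subset[OF a order_refl] residue_rep(2)[OF za]])
      then have "z - a * ?w \<in> frac_ideal (m + 1)"
        using shell_nonzero[OF a] by (simp add: algebra_simps)
      then have "(?T z, ?T (a * ?w)) \<in> R"
        using R_iff z aw[OF residue_rep(1)[OF za]] by blast
      then have "R `` {?T z} = R `` {?T (a * ?w)}"
        by (rule equiv_class_eq[OF equiv])
      then show ?thesis
        using residue_rep(1)[OF za] by blast
    qed
    then have "torus_quotient \<pi> r \<subseteq> (\<lambda>w. R `` {?T (a * w)}) ` residue_reps"
      unfolding tq ge by (intro subsetI, elim quotientE) blast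
    moreover have "R `` {?T (a * w)} \<in> torus_quotient \<pi> r" if "w \<in> residue_reps" for w
      unfolding tq ge using aw[OF that] by (intro quotientI) blast
    ultimately show "(\<lambda>w. R `` {?T (a * w)}) ` residue_reps = torus_quotient \<pi> r"
      by blast
  qed
  have "F (SOME Z. Z \<in> R `` {?T (a * w)}) = F (?T (a * w))" if w: "w \<in> residue_reps" for w
  proof -
    define Z where "Z = (SOME Z. Z \<in> R `` {?T (a * w)})"
    have "?T (a * w) \<in> R `` {?T (a * w)}"
      using aw[OF w] R_iff by simp
    then have "Z \<in> R `` {?T (a * w)}"
      unfolding Z_def by (rule someI)
    then have Z: "(?T (a * w), Z) \<in> R"
      by simp
    then have "Z \<in> ?T ` frac_ideal m"
      using R_sub ge by blast
    then obtain z where z: "Z = ?T z"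
      by blast
    have "F (?T (a * w + (z - a * w))) = F (?T (a * w))"
      using Z aw[OF w] unfolding z R_iff by (intro F) (simp_all add: frac_ideal_diff_commute)
    then show ?thesis
      unfolding Z_def[symmetric] z by simp
  qed
  then have "(\<Sum>w\<in>residue_reps. F (SOME Z. Z \<in> R `` {?T (a * w)})) =
      (\<Sum>w\<in>residue_reps. F (?T (a * w)))"
    by (rule sum.cong[OF refl])
  then show ?thesis
    unfolding sum.reindex_bij_betw[OF bij, of "\<lambda>C. F (SOME Z. Z \<in> C)"] .
qed

text \<open>As \<open>2 * \<beta> * \<pi>\<close> has valuation b + 1, the character is trivial on
  \<open>frac_ideal (c - b - 1)\<close> but not on the next larger ideal. The strict inequality in
  the definition makes the maximal \<rho> equal to minus the depth c - b - 3/2 of that last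
  nontrivial layer.\<close>

lemma dual_depth_eq:
  fixes \<Phi> :: "'k::nonarch_local_field \<Rightarrow> complex"
  assumes \<Phi>: "additive_character \<Phi>" and cond: "has_conductor \<Phi> c"
    and two: "(2 :: 'k) \<notin> max_ideal" and \<pi>: "uniformiser \<pi>" and \<beta>: "\<beta> \<in> shell b"
  shows "dual_depth \<Phi> \<pi> (trace_functional (torus_elem \<pi> \<beta>)) = of_int (b - c) + 3 / 2"
  unfolding dual_depth_def
proof (rule Greatest_equality)
  have \<pi>1: "\<pi> \<in> shell 1"
    using \<pi> by (simp add: uniformiser_def shell_def)
  have u: "2 * \<beta> * \<pi> \<in> shell (b + 1)"
    using shell_mult[OF shell_mult[OF shell_two[OF two] \<beta>] \<pi>1] by simp
  show "\<forall>Z\<in>torus_lie \<pi>. depth \<pi> Z > ereal (- (of_int (b - c) + 3 / 2)) \<longrightarrow>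
      \<Phi> (trace_functional (torus_elem \<pi> \<beta>) Z) = 1"
  proof (clarsimp simp: torus_lie_def trace_functional_torus_elem)
    fix z
    assume "depth \<pi> (torus_elem \<pi> z) > ereal (of_int c - of_int b - 3 / 2)"
    then have "z \<in> frac_ideal (c - b - 1)"
      by (auto simp: depth_torus_elem_uniformiser[OF \<pi>] frac_ideal_def split: if_splits)
    then have "2 * \<beta> * \<pi> * z \<in> frac_ideal c"
      by (rule frac_ideal_mult'[OF shell_subset[OF u order_refl]]) simp
    then show "\<Phi> (2 * \<beta> * z * \<pi>) = 1"
      using character_trivial[OF \<Phi> cond] by (simp add: ac_simps)
  qed
  fix \<rho>
  assume \<rho>: "\<forall>Z\<in>torus_lie \<pi>. depth \<pi> Z > ereal (- \<rho>) \<longrightarrow> \<Phi> (trace_functional (torus_elem \<pi> \<beta>) Z) = 1"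
  obtain x where x: "x \<in> frac_ideal (c - 1)" "\<Phi> x \<noteq> 1"
    using character_nontrivial[OF \<Phi> cond] by blast
  \<comment> \<open>Its pairing with the functional is x, where \<Phi> is not 1, so no admissible
    \<rho> can exceed minus its depth.\<close>
  let ?z = "x / (2 * \<beta> * \<pi>)"
  have "x \<noteq> 0"
    using x(2) additive_character_0[OF \<Phi>] by auto
  then have z: "?z \<noteq> 0" "?z \<in> frac_ideal (c - b - 2)"
    using shell_nonzero[OF u] frac_ideal_divide_shell[OF x(1) u, of "c - b - 2"] by auto
  have "trace_functional (torus_elem \<pi> \<beta>) (torus_elem \<pi> ?z) = x"
    using shell_nonzero[OF u] by (simp add: trace_functional_torus_elem field_simps)
  then have "\<not> depth \<pi> (torus_elem \<pi> ?z) > ereal (- \<rho>)"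
    using \<rho> x(2) by (auto simp: torus_lie_def)
  then have "of_int (ord ?z) + 1 / 2 \<le> - \<rho>"
    using z(1) by (simp add: depth_torus_elem_uniformiser[OF \<pi>] not_less del: divide_eq_0_iff)
  moreover have "c - b - 2 \<le> ord ?z"
    using z by (simp add: frac_ideal_def)
  then have "real_of_int (c - b - 2) \<le> of_int (ord ?z)"
    by (simp only: of_int_le_iff)
  ultimately show "\<rho> \<le> of_int (b - c) + 3 / 2"
    by simp
qed

section \<open>The mock Fourier transform\<close>

context
  fixes \<Phi> :: "'k::nonarch_local_field \<Rightarrow> complex" and c :: int
    and \<mu> :: "'k measure" and q :: real and \<pi> :: 'k
  assumes \<Phi>: "additive_character \<Phi>" and cond: "has_conductor \<Phi> c"
    and haar: "normalised_haar \<mu>" and q_def: "q = real (residue_card TYPE('k))"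
    and two: "(2 :: 'k) \<notin> max_ideal"
    and \<pi>: "uniformiser \<pi>"
begin

lemmas \<Phi>_add = character_add[OF \<Phi> cond]
lemmas \<Phi>_cong = character_cong[OF \<Phi> cond]
lemmas gauss_cong = gauss_integral_cong[OF \<Phi> cond haar two]

text \<open>The part of the phase free of t leaves the inner sum, and \<open>1 / abs_val x\<close>
  is the constant \<open>q powi n\<close> on each shell.\<close>

lemma mock_fourier_eq_gauss:
  "mock_fourier \<Phi> \<mu> \<pi> \<beta> \<theta> s =
    (\<Sum>\<^sub>\<infinity>n\<in>(UNIV :: int set). of_real (q powi n) * (LINT x:shell n|\<mu>. indicator (norm_group \<pi>) x *
      (\<Phi> (\<beta> * s * \<theta> * x + \<beta> * s * \<pi> * inverse x) * gauss_integral \<Phi> \<mu> (- (\<beta> * s * inverse x)))))"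
proof -
  have "(\<Sum>\<^sub>\<infinity>l\<in>(UNIV :: int set). LINT t:shell l|\<mu>. \<Phi> (\<beta> * s * (x * \<theta> + inverse x * \<pi> - inverse x * t\<^sup>2)))
      = \<Phi> (\<beta> * s * \<theta> * x + \<beta> * s * \<pi> * inverse x) * gauss_integral \<Phi> \<mu> (- (\<beta> * s * inverse x))" for x
  proof -
    have "\<Phi> (\<beta> * s * (x * \<theta> + inverse x * \<pi> - inverse x * t\<^sup>2)) =
        \<Phi> (\<beta> * s * \<theta> * x + \<beta> * s * \<pi> * inverse x) * \<Phi> (- (\<beta> * s * inverse x) * t\<^sup>2)" for t
      unfolding \<Phi>_add[symmetric] by (rule arg_cong[where f = \<Phi>]) (simp add: algebra_simps)
    then show ?thesis
      by (simp add: gauss_integral_def infsum_cmult_right' set_lebesgue_integral_def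
          mult.left_commute[of "complex_of_real _"] scaleR_conv_of_real)
  qed
  then show ?thesis
    by (simp add: mock_fourier_def set_integral_mult_haar[OF haar q_def])
qed

section \<open>The outer integral, for a phase balanced on the shell of valuation -j\<close>

context
  fixes A B \<gamma> :: 'k and j :: int
  assumes A: "A \<in> shell (c - 1 + j)" and B: "B \<in> shell (c - 1 - j)" and \<gamma>: "\<gamma> \<in> shell (c - 2 - j)"
begin

lemma gauss_factor_cong:
  assumes x: "x \<in> shell n" and u: "u \<in> frac_ideal (n + 1)"
  shows "gauss_integral \<Phi> \<mu> (\<gamma> * inverse (x + u)) = gauss_integral \<Phi> \<mu> (\<gamma> * inverse x)"
proof -
  have "\<gamma> * (inverse (x + u) - inverse x) \<in> frac_ideal (c - 2 - j + - n + 1)"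
    using frac_ideal_mult[OF shell_subset[OF \<gamma> order_refl] inverse_add_cong[OF x u]]
    by (simp add: algebra_simps)
  then show ?thesis
    using gauss_cong[OF shell_mult[OF \<gamma> shell_inverse[OF x]], of "\<gamma> * (inverse (x + u) - inverse x)"]
    by (simp add: algebra_simps)
qed

text \<open>With N = n + j the terms A x and B/x have valuations c - 1 + N and c - 1 - N. For N > 0
  the second oscillates alone, for N < 0 the first; the norm condition and the Gaussian factor
  depend only on the leading term of x.\<close>

lemma outer_integral_vanish:
  assumes n: "n \<noteq> - j"
  shows "(LINT x:shell n|\<mu>. indicator (norm_group \<pi>) x *
    (\<Phi> (A * x + B * inverse x) * gauss_integral \<Phi> \<mu> (\<gamma> * inverse x))) = 0"
proof -
  define N where "N = n + j"
  \<comment> \<open>A shift of this size changes the dominant term at level c - 1 exactly and the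
    other one at level c - 1 + 2\<bar>N\<bar>.\<close>
  define k where "k = n + \<bar>N\<bar>"
  have N: "N \<noteq> 0"
    using n by (simp add: N_def)
  obtain b :: 'k where b: "b \<in> shell k"
    using shell_nonempty by blast
  show ?thesis
  proof (rule set_integral_shell_vanish[OF \<Phi> cond haar two b])
    show "k > n"
      using N by (simp add: k_def)
  next
    fix x :: 'k
    assume x: "x \<in> shell n"
    \<comment> \<open>The linear coefficient of the dominant term: the derivative of B/x or of A x,
      times b. The other coefficient goes into \<open>small\<close>, the higher-order part of B/x
      into \<open>rest\<close>.\<close>
    let ?d = "if N > 0 then - (B * b / x\<^sup>2) else A * b"
    have Bb: "B * b / x\<^sup>2 \<in> shell (c - 1 - j + k - 2 * n)"
      using shell_divide[OF shell_mult[OF B b] shell_power[OF x, of 2]] by simp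
    have Ab: "A * b \<in> shell (c - 1 + j + k)"
      using shell_mult[OF A b] .
    have d: "?d \<in> shell (c - 1)"
      using shell_minus[OF Bb] Ab N by (auto simp: N_def k_def split: if_splits)
    have "\<Phi> (A * (x + b * w) + B * inverse (x + b * w)) = \<Phi> (A * x + B * inverse x) * \<Phi> (?d * w)"
      if w: "w \<in> frac_ideal 0" for w
    proof -
      have "b * w \<in> frac_ideal (n + \<bar>N\<bar>)"
        using frac_ideal_mult[OF shell_subset[OF b order_refl] w] by (simp add: k_def)
      then have "inverse (x + b * w) - (inverse x - b * w / x\<^sup>2) \<in> frac_ideal (2 * \<bar>N\<bar> - n)"
        using N by (intro inverse_add_expansion[OF x]) auto
      moreover have "c \<le> c - 1 - j + (2 * \<bar>N\<bar> - n)"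
        using N unfolding N_def by arith
      ultimately have rest: "B * (inverse (x + b * w) - (inverse x - b * w / x\<^sup>2)) \<in> frac_ideal c"
        by (rule frac_ideal_mult'[OF shell_subset[OF B order_refl]])
      have small: "(if N > 0 then A * b else - (B * b / x\<^sup>2)) * w \<in> frac_ideal c"
        using N by (intro frac_ideal_mult'[OF _ w, of _ c])
          (auto simp: N_def k_def intro: shell_subset[OF Ab] shell_subset[OF Bb])
      have "A * (x + b * w) + B * inverse (x + b * w) - ((A * x + B * inverse x) + ?d * w) =
          B * (inverse (x + b * w) - (inverse x - b * w / x\<^sup>2)) +
          (if N > 0 then A * b else - (B * b / x\<^sup>2)) * w"
        by (simp add: algebra_simps)
      then show ?thesis
        unfolding \<Phi>_add[symmetric] using frac_ideal_add[OF rest small] by (intro \<Phi>_cong) simp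
    qed
    moreover have "indicator (norm_group \<pi>) (x + b * w) = (indicator (norm_group \<pi>) x :: complex)"
      "gauss_integral \<Phi> \<mu> (\<gamma> * inverse (x + b * w)) = gauss_integral \<Phi> \<mu> (\<gamma> * inverse x)"
      if w: "w \<in> frac_ideal 0" for w
    proof -
      have u: "b * w \<in> frac_ideal (n + 1)"
        using N by (intro frac_ideal_mult'[OF shell_subset[OF b order_refl] w]) (auto simp: k_def)
      show "indicator (norm_group \<pi>) (x + b * w) = (indicator (norm_group \<pi>) x :: complex)"
        using norm_group_cong[OF two \<pi> x u] by (simp add: indicator_def)
      show "gauss_integral \<Phi> \<mu> (\<gamma> * inverse (x + b * w)) = gauss_integral \<Phi> \<mu> (\<gamma> * inverse x)"
        by (rule gauss_factor_cong[OF x u])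
    qed
    ultimately show "\<exists>C. \<exists>d\<in>shell (c - 1). \<forall>w\<in>frac_ideal 0. indicator (norm_group \<pi>) (x + b * w) *
        (\<Phi> (A * (x + b * w) + B * inverse (x + b * w)) *
          gauss_integral \<Phi> \<mu> (\<gamma> * inverse (x + b * w))) = C * \<Phi> (d * w)"
      using d by (intro exI[of _ "indicator (norm_group \<pi>) x *
        (\<Phi> (A * x + B * inverse x) * gauss_integral \<Phi> \<mu> (\<gamma> * inverse x))"] bexI[of _ ?d])
        (simp_all only: mult_ac simp_thms ball_simps, auto)
  qed
qed

text \<open>Both phase terms now have valuation c - 1, so everything is constant on cosets of the
  next ideal. One factor 1/q is the multiplicative volume of such a coset, the other is the Gaussian
  integral.\<close>

lemma outer_integral_eq:
  assumes a: "a \<in> shell (- j)"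
  shows "of_real (q powi (- j)) * (LINT x:shell (- j)|\<mu>. indicator (norm_group \<pi>) x *
      (\<Phi> (A * x + B * inverse x) * gauss_integral \<Phi> \<mu> (\<gamma> * inverse x))) =
    of_real (inverse (q\<^sup>2)) *
      (\<Sum>y | y \<in> unit_reps \<and> a * y \<in> norm_group \<pi>. \<Phi> (A * (a * y) + B * inverse (a * y)))"
proof -
  note q = q_gt_1[OF q_def]
  let ?f = "\<lambda>x. indicator (norm_group \<pi>) x *
    (\<Phi> (A * x + B * inverse x) * gauss_integral \<Phi> \<mu> (\<gamma> * inverse x))"
  have inv: "?f (x + u) = ?f x" if x: "x \<in> shell (- j)" and u: "u \<in> frac_ideal (- j + 1)" for x u
  proof -
    have "A * u + B * (inverse (x + u) - inverse x) \<in> frac_ideal c"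
      by (intro frac_ideal_add frac_ideal_mult'[OF shell_subset[OF A order_refl] u]
          frac_ideal_mult'[OF shell_subset[OF B order_refl] inverse_add_cong[OF x u]]) auto
    then have "\<Phi> (A * (x + u) + B * inverse (x + u)) = \<Phi> (A * x + B * inverse x)"
      by (intro \<Phi>_cong) (simp add: algebra_simps)
    then show ?thesis
      using norm_group_cong[OF two \<pi> x u] gauss_factor_cong[OF x u] by (simp add: indicator_def)
  qed
  have coeff: "?f (a * y) = of_real (inverse q) *
      (if a * y \<in> norm_group \<pi> then \<Phi> (A * (a * y) + B * inverse (a * y)) else 0)"
    if "y \<in> unit_reps" for y
  proof -
    have "\<gamma> * inverse (a * y) \<in> shell (c - 2 - j + - (- j + 0))"
      using that by (intro shell_mult \<gamma> shell_inverse a) (auto simp: unit_reps_def)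
    then have "gauss_integral \<Phi> \<mu> (\<gamma> * inverse (a * y)) = of_real (inverse q)"
      by (intro gauss_integral_eq[OF \<Phi> cond haar two q_def]) simp_all
    then show ?thesis
      by (simp add: indicator_def)
  qed
  have "(LINT x:shell (- j)|\<mu>. ?f x) = of_real (q powi (- (- j + 1))) * (\<Sum>y\<in>unit_reps. ?f (a * y))"
    by (rule set_integral_shell[OF haar q_def a inv])
  also have "(\<Sum>y\<in>unit_reps. ?f (a * y)) = of_real (inverse q) *
      (\<Sum>y | y \<in> unit_reps \<and> a * y \<in> norm_group \<pi>. \<Phi> (A * (a * y) + B * inverse (a * y)))"
    unfolding sum.inter_filter[OF finite_unit_reps] sum_distrib_left
    by (intro sum.cong refl) (rule coeff)
  finally have *: "(LINT x:shell (- j)|\<mu>. ?f x) = of_real (q powi (- (- j + 1)) * inverse q) *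
      (\<Sum>y | y \<in> unit_reps \<and> a * y \<in> norm_group \<pi>. \<Phi> (A * (a * y) + B * inverse (a * y)))"
    by simp
  have "q powi (- j) * (q powi (- (- j + 1)) * inverse q) = inverse (q\<^sup>2)"
    using q by (simp add: power_int_diff power_int_minus power2_eq_square field_simps)
  then show ?thesis
    unfolding * by (simp only: mult.assoc[symmetric] of_real_mult[symmetric])
qed

end

text \<open>Only the shell \<open>ord x = -j\<close> contributes, and on it the Gaussian integral is the constant \<open>q\<^sup>-\<^sup>1\<close>.\<close>

lemma mock_fourier_eq_sum:
  assumes \<epsilon>: "\<epsilon> \<in> shell 0" "\<not> is_square \<epsilon>" and \<theta>: "\<theta> = \<epsilon> * \<pi> * ((- \<pi>) powi j)\<^sup>2"
    and \<beta>: "\<beta> \<in> shell b" and s: "s \<in> shell (c - b - 2 - j)"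
  shows "mock_fourier \<Phi> \<mu> \<pi> \<beta> \<theta> s = of_real (inverse (q\<^sup>2)) *
    (\<Sum>w | w \<in> residue_reps \<and> is_square (w\<^sup>2 - \<epsilon>). \<Phi> (2 * \<beta> * (s * (- \<pi>) powi j) * \<pi> * w))"
proof -
  let ?v = "(- \<pi>) powi j" and ?A = "\<beta> * s * \<theta>" and ?B = "\<beta> * s * \<pi>" and ?\<gamma> = "- (\<beta> * s)"
  let ?d = "2 * \<beta> * (s * ?v) * \<pi>"
  have \<pi>1: "\<pi> \<in> shell 1"
    using \<pi> by (simp add: uniformiser_def shell_def)
  have v: "?v \<in> shell j"
    using shell_power_int[OF shell_minus[OF \<pi>1], of j] by simp
  have \<theta>1: "\<theta> \<in> shell (0 + 1 + int 2 * j)"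
    unfolding \<theta> by (intro shell_mult shell_power \<epsilon> \<pi>1 v)
  have \<beta>s: "\<beta> * s \<in> shell (c - 2 - j)"
    using shell_mult[OF \<beta> s] by (simp add: algebra_simps)
  have A: "?A \<in> shell (c - 1 + j)"
    using shell_mult[OF \<beta>s \<theta>1] by (simp add: algebra_simps)
  have B: "?B \<in> shell (c - 1 - j)"
    using shell_mult[OF \<beta>s \<pi>1] by (simp add: algebra_simps)
  have \<gamma>: "?\<gamma> \<in> shell (c - 2 - j)"
    using shell_minus[OF \<beta>s] .
  have d: "?d \<in> shell (c - 1)"
    using shell_mult[OF shell_mult[OF shell_mult[OF shell_two[OF two] \<beta>] shell_mult[OF s v]] \<pi>1]
    by (simp add: algebra_simps)
  have a: "inverse ?v \<in> shell (- j)"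
    using shell_inverse[OF v] .
  let ?I = "\<lambda>n. of_real (q powi n) * (LINT x:shell n|\<mu>. indicator (norm_group \<pi>) x *
      (\<Phi> (?A * x + ?B * inverse x) * gauss_integral \<Phi> \<mu> (?\<gamma> * inverse x)))"
  have "mock_fourier \<Phi> \<mu> \<pi> \<beta> \<theta> s = (\<Sum>\<^sub>\<infinity>n\<in>(UNIV :: int set). ?I n)"
    by (simp add: mock_fourier_eq_gauss)
  also have "\<dots> = (\<Sum>\<^sub>\<infinity>n\<in>{- j}. ?I n)"
    using outer_integral_vanish[OF A B \<gamma>] by (intro infsum_cong_neutral) auto
  also have "\<dots> = ?I (- j)"
    by simp
  also have "\<dots> = of_real (inverse (q\<^sup>2)) * (\<Sum>y | y \<in> unit_reps \<and> inverse ?v * y \<in> norm_group \<pi>.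
      \<Phi> (?A * (inverse ?v * y) + ?B * inverse (inverse ?v * y)))"
    by (rule outer_integral_eq[OF A B \<gamma> a])
  also have "(\<Sum>y | y \<in> unit_reps \<and> inverse ?v * y \<in> norm_group \<pi>.
      \<Phi> (?A * (inverse ?v * y) + ?B * inverse (inverse ?v * y))) =
      (\<Sum>y | y \<in> unit_reps \<and> is_square y. \<Phi> (?d * ((\<epsilon> * y + inverse y) / 2)))"
  proof (rule sum.cong)
    show "{y \<in> unit_reps. inverse ?v * y \<in> norm_group \<pi>} = {y \<in> unit_reps. is_square y}"
      using norm_group_power_mult[OF two \<pi>] by (auto simp: unit_reps_def)
    fix y
    \<comment> \<open>The substitution x = y/v gives both terms the common factor
      \<open>\<beta> * s * v * \<pi>\<close>, because \<theta> contains \<open>v\<^sup>2\<close>;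
      what remains is \<open>\<epsilon> * y + inverse y\<close>.\<close>
    have "?A * inverse ?v = \<beta> * s * ?v * \<pi> * \<epsilon>"
      using shell_nonzero[OF v] by (simp add: \<theta> power2_eq_square field_simps)
    then have "?A * inverse ?v * y + ?B * (?v * inverse y) = \<beta> * s * ?v * \<pi> * \<epsilon> * y + ?B * (?v * inverse y)"
      by (simp only:)
    moreover have "?A * (inverse ?v * y) + ?B * inverse (inverse ?v * y) =
        ?A * inverse ?v * y + ?B * (?v * inverse y)"
      by (simp add: mult.assoc)
    ultimately have "?A * (inverse ?v * y) + ?B * inverse (inverse ?v * y) =
        \<beta> * s * ?v * \<pi> * (\<epsilon> * y + inverse y)"
      by (simp add: algebra_simps)
    also have "\<dots> = ?d * ((\<epsilon> * y + inverse y) / 2)"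
      using shell_nonzero[OF shell_two[OF two]] by simp
    finally show "\<Phi> (?A * (inverse ?v * y) + ?B * inverse (inverse ?v * y)) =
        \<Phi> (?d * ((\<epsilon> * y + inverse y) / 2))"
      by simp
  qed
  also have "\<dots> = (\<Sum>w | w \<in> residue_reps \<and> is_square (w\<^sup>2 - \<epsilon>). \<Phi> (?d * w))"
  proof (rule sum_quadratic_substitution[OF two \<epsilon>])
    fix x y :: 'k
    assume "x - y \<in> frac_ideal 1"
    then have "?d * (x - y) \<in> frac_ideal c"
      by (rule frac_ideal_mult'[OF shell_subset[OF d order_refl]]) simp
    then show "\<Phi> (?d * x) = \<Phi> (?d * y)"
      by (intro \<Phi>_cong) (simp only: right_diff_distrib)
  qed
  finally show ?thesis .
qed

end

text \<open>The argument of the character is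
  \<open>- \<pi> * a\<^sup>2 * (w\<^sup>2 - \<epsilon>)\<close>, and
  \<open>- \<pi> * a\<^sup>2\<close> is a norm, so only the unit
  \<open>w\<^sup>2 - \<epsilon>\<close> decides the sign.\<close>

lemma sum_quad_char_eq:
  fixes \<Phi> :: "'k::nonarch_local_field \<Rightarrow> complex"
  assumes \<Phi>: "additive_character \<Phi>" and cond: "has_conductor \<Phi> c"
    and two: "(2 :: 'k) \<notin> max_ideal" and \<pi>: "uniformiser \<pi>"
    and \<epsilon>: "\<epsilon> \<in> shell 0" "\<not> is_square \<epsilon>" and d: "d \<in> shell (c - 1)" and a: "a \<noteq> 0"
  shows "(\<Sum>w\<in>residue_reps. \<Phi> (d * w) * of_int (quad_char \<pi> (\<epsilon> * \<pi> * a\<^sup>2 - (a * w)\<^sup>2 * \<pi>))) =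
    2 * (\<Sum>w | w \<in> residue_reps \<and> is_square (w\<^sup>2 - \<epsilon>). \<Phi> (d * w))"
proof -
  have \<pi>0: "\<pi> \<noteq> 0" "ord \<pi> = 1"
    using \<pi> by (auto simp: uniformiser_def)
  have char: "quad_char \<pi> (\<epsilon> * \<pi> * a\<^sup>2 - (a * w)\<^sup>2 * \<pi>) = (if is_square (w\<^sup>2 - \<epsilon>) then 1 else - 1)"
    if "w \<in> residue_reps" for w
  proof -
    let ?x = "\<epsilon> * \<pi> * a\<^sup>2 - (a * w)\<^sup>2 * \<pi>"
    have w: "w \<in> frac_ideal 0"
      using that residue_reps_subset by blast
    have "w\<^sup>2 - \<epsilon> \<noteq> 0" "ord (w\<^sup>2 - \<epsilon>) = 0"
      using square_diff_nonsquare_unit[OF two w \<epsilon>] by (simp_all add: shell_def)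
    moreover have x: "?x = - \<pi> * (a\<^sup>2 * (w\<^sup>2 - \<epsilon>))"
      by (simp add: power_mult_distrib algebra_simps)
    ultimately have "?x \<noteq> 0" "odd (ord ?x)"
      using \<pi>0 a by (simp_all add: ord_mult ord_power del: mult_minus_left)
    moreover have "- ?x / \<pi> = a\<^sup>2 * (w\<^sup>2 - \<epsilon>)"
      unfolding x using \<pi>0 by simp
    ultimately show ?thesis
      using norm_group_odd[OF two \<pi>, of ?x] a by (simp add: quad_char_def)
  qed
  have "(\<Sum>w\<in>residue_reps. \<Phi> (d * w) * of_int (quad_char \<pi> (\<epsilon> * \<pi> * a\<^sup>2 - (a * w)\<^sup>2 * \<pi>))) =
      (\<Sum>w\<in>residue_reps. 2 * (if is_square (w\<^sup>2 - \<epsilon>) then \<Phi> (d * w) else 0) - \<Phi> (d * w))"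
    by (intro sum.cong) (auto simp: char)
  also have "\<dots> = 2 * (\<Sum>w\<in>residue_reps. if is_square (w\<^sup>2 - \<epsilon>) then \<Phi> (d * w) else 0)"
    using sum_character[OF \<Phi> cond d] by (simp add: sum_subtractf sum_distrib_left)
  finally show ?thesis
    by (simp add: sum.inter_filter[OF finite_residue_reps, symmetric])
qed

theorem theorem10p4:
  fixes \<Phi> :: "'k::nonarch_local_field \<Rightarrow> complex"
    and \<mu> :: "'k measure"
    and \<pi> \<beta> s \<theta>' :: 'k
    and X :: "'k^2^2 \<Rightarrow> 'k"
    and Y :: "'k^2^2"
    and q r h :: real
  assumes "(2 :: 'k) \<notin> max_ideal"
    and "additive_character \<Phi>" and "\<exists>x. \<Phi> x \<noteq> 1"
    and "normalised_haar \<mu>"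
    and "uniformiser \<pi>"
    and "\<beta> \<noteq> 0" and "s \<noteq> 0" and "\<theta>' \<noteq> 0"
    and "q = real (residue_card TYPE('k))"
    and "X = trace_functional (smult_mat \<beta> (sqrt_mat \<pi>))"
    and "Y = smult_mat s (sqrt_mat \<theta>')"
    and "r = - dual_depth \<Phi> \<pi> X"
    and "h = r + 1 / 2"
    and "ereal (dual_depth \<Phi> \<pi> X) + depth \<theta>' Y = 0"
    and "ramified_torus \<theta>'"
    and "\<not> stably_conjugate_tori \<theta>' \<pi>"
  shows "mock_fourier \<Phi> \<mu> \<pi> \<beta> \<theta>' s =
    complex_of_real (1 / 2 * q powr (- (h + 1)) * q powr (- 1 / 2) * abs_val (disc_g Y) powr (- 1 / 2)) *
    (\<Sum>C \<in> torus_quotient \<pi> r.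
       let Z = (SOME Z. Z \<in> C)
       in \<Phi> (X Z) * of_int (quad_char \<pi> (scalar_of_mat (Y ** Y) - scalar_of_mat (Z ** Z))))"
proof -
  note two = assms(1) and \<Phi> = assms(2) and haar = assms(4) and \<pi> = assms(5) and q_def = assms(9)
  obtain c where cond: "has_conductor \<Phi> c"
    using additive_character_conductor[OF \<Phi> assms(3)] by blast
  note q = q_gt_1[OF q_def]
  have \<pi>1: "\<pi> \<in> shell 1"
    using \<pi> by (simp add: uniformiser_def shell_def)
  note \<pi>0 = shell_nonzero[OF \<pi>1]
  define b where "b = ord \<beta>"
  \<comment> \<open>The valuation of the coefficients of elements of depth exactly r, which is m +
    1/2.\<close>
  define m where "m = c - b - 2"
  have \<beta>: "\<beta> \<in> shell b"
    using assms(6) by (simp add: shell_def b_def)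
  have dual: "dual_depth \<Phi> \<pi> X = of_int (b - c) + 3 / 2"
    unfolding assms(10) by (rule dual_depth_eq[OF \<Phi> cond two \<pi> \<beta>])
  then have r: "r = of_int m + 1 / 2" and h: "h = of_int m + 1"
    using assms(12,13) by (simp_all add: m_def)
  obtain j where j: "ord \<theta>' = 2 * j + 1"
    using assms(15) by (auto simp: ramified_torus_def elim: oddE)
  \<comment> \<open>Doubled, the depth condition reads 2 \<open>ord s\<close> + 2j + 1 = 2m + 1;
    this is the balance of valuations on which the collapse to one shell depends.\<close>
  have "ereal (of_int (b - c) + 3 / 2) + ereal (of_int (2 * ord s + ord \<theta>') / 2) = 0"
    using assms(14) depth_torus_elem[OF assms(8), of s] assms(7) by (simp add: dual assms(11))
  then have "real_of_int (2 * ord s + ord \<theta>') = real_of_int (2 * m + 1)"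
    by (simp add: m_def zero_ereal_def field_simps)
  then have ord_s: "ord s = m - j"
    using j by (simp only: of_int_eq_iff)
  define v where "v = (- \<pi>) powi j"
  have v: "v \<in> shell j"
    using shell_power_int[OF shell_minus[OF \<pi>1], of j] by (simp add: v_def)
  define \<epsilon> where "\<epsilon> = \<theta>' / (\<pi> * v\<^sup>2)"
  have \<theta>: "\<theta>' = \<epsilon> * \<pi> * v\<^sup>2"
    using \<pi>0 shell_nonzero[OF v] by (simp add: \<epsilon>_def)
  have "\<theta>' \<in> shell (2 * j + 1)"
    using assms(8) j by (simp add: shell_def)
  from shell_divide[OF this shell_mult[OF \<pi>1 shell_power[OF v, of 2]]]
  have \<epsilon>0: "\<epsilon> \<in> shell 0"
    by (simp add: \<epsilon>_def)
  have \<epsilon>: "\<not> is_square \<epsilon>"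
  proof
    assume "is_square \<epsilon>"
    then obtain e where "\<epsilon> = e\<^sup>2"
      by (auto simp: is_square_def)
    then have "\<theta>' = \<pi> * (e * v)\<^sup>2" "e * v \<noteq> 0"
      using \<theta> assms(8) by (auto simp: power_mult_distrib)
    then show False
      using assms(16) unfolding stably_conjugate_tori_def by blast
  qed
  have s: "s \<in> shell (c - b - 2 - j)"
    using ord_s assms(7) by (simp add: shell_def m_def)
  \<comment> \<open>With this scale \<open>Y\<^sup>2\<close> is
    \<open>\<epsilon> * \<pi> * a\<^sup>2\<close>, so Y is compared with the elements of coefficient
    \<open>a * w\<close>, which run through the quotient at depth r.\<close>
  define a where "a = s * v"
  have a: "a \<in> shell m"
    using shell_mult[OF s v] by (simp add: a_def m_def)
  define d where "d = 2 * \<beta> * a * \<pi>"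
  have d: "d \<in> shell (c - 1)"
    using shell_mult[OF shell_mult[OF shell_mult[OF shell_two[OF two] \<beta>] a] \<pi>1]
    by (simp add: d_def m_def)
  let ?W = "\<Sum>w | w \<in> residue_reps \<and> is_square (w\<^sup>2 - \<epsilon>). \<Phi> (d * w)"
  have lhs: "mock_fourier \<Phi> \<mu> \<pi> \<beta> \<theta>' s = of_real (inverse (q\<^sup>2)) * ?W"
    using mock_fourier_eq_sum[OF \<Phi> cond haar q_def two \<pi> \<epsilon>0 \<epsilon> _ \<beta> s, of \<theta>'] \<theta>
    by (simp add: v_def a_def d_def)
  define F where "F Z = \<Phi> (X Z) *
    of_int (quad_char \<pi> (scalar_of_mat (Y ** Y) - scalar_of_mat (Z ** Z)))" for Z
  have Y2: "scalar_of_mat (Y ** Y) = \<epsilon> * \<pi> * a\<^sup>2"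
    unfolding assms(11) scalar_of_torus_elem_square by (simp add: \<theta> a_def power_mult_distrib)
  have F_eq: "F (torus_elem \<pi> z) = \<Phi> (2 * \<beta> * z * \<pi>) * of_int (quad_char \<pi> (\<epsilon> * \<pi> * a\<^sup>2 - z\<^sup>2 * \<pi>))" for z
    by (simp only: F_def Y2 scalar_of_torus_elem_square assms(10) trace_functional_torus_elem)
  have "(\<Sum>C\<in>torus_quotient \<pi> r. F (SOME Z. Z \<in> C)) = (\<Sum>w\<in>residue_reps. F (torus_elem \<pi> (a * w)))"
  proof (rule sum_torus_quotient[OF \<pi> a r])
    fix z u :: 'k
    assume z: "z \<in> frac_ideal m" and u: "u \<in> frac_ideal (m + 1)"
    have "2 * \<beta> * \<pi> * u \<in> frac_ideal c"
      using shell_mult[OF shell_mult[OF shell_two[OF two] \<beta>] \<pi>1]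
      by (intro frac_ideal_mult'[OF shell_subset[OF _ order_refl] u]) (auto simp: m_def)
    then have "\<Phi> (2 * \<beta> * (z + u) * \<pi>) = \<Phi> (2 * \<beta> * z * \<pi>)"
      by (intro character_cong[OF \<Phi> cond]) (simp_all add: algebra_simps)
    \<comment> \<open>The difference of squares has valuation exactly 2m + 1, since
      \<open>\<epsilon> - (z / a)\<^sup>2\<close> is a unit, while u alters it only from level 2m +
      2 on.\<close>
    moreover have "quad_char \<pi> (\<epsilon> * \<pi> * a\<^sup>2 - (z + u)\<^sup>2 * \<pi>) = quad_char \<pi> (\<epsilon> * \<pi> * a\<^sup>2 - z\<^sup>2 * \<pi>)"
    proof -
      have za: "z / a \<in> frac_ideal 0"
        using frac_ideal_divide_shell[OF z a] by simp
      have "\<epsilon> - (z / a)\<^sup>2 \<in> shell 0"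
        using shell_minus[OF square_diff_nonsquare_unit[OF two za \<epsilon>0 \<epsilon>]] by simp
      from shell_mult[OF shell_mult[OF this \<pi>1] shell_power[OF a, of 2]]
      have "(\<epsilon> - (z / a)\<^sup>2) * \<pi> * a\<^sup>2 \<in> shell (2 * m + 1)"
        by (simp add: add.commute)
      moreover have "(\<epsilon> - (z / a)\<^sup>2) * \<pi> * a\<^sup>2 = \<epsilon> * \<pi> * a\<^sup>2 - z\<^sup>2 * \<pi>"
      proof -
        have "(z / a)\<^sup>2 * a\<^sup>2 = z\<^sup>2"
          using shell_nonzero[OF a] by (simp add: power_divide)
        then show ?thesis
          by algebra
      qed
      ultimately have sh: "\<epsilon> * \<pi> * a\<^sup>2 - z\<^sup>2 * \<pi> \<in> shell (2 * m + 1)"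
        by (simp only:)
      have "z + u + z \<in> frac_ideal m"
        using z u frac_ideal_mono[OF u, of m] by (intro frac_ideal_add) auto
      then have "- (u * (z + u + z) * \<pi>) \<in> frac_ideal (2 * m + 1 + 1)"
        unfolding frac_ideal_minus_iff
        by (intro frac_ideal_mult'[OF frac_ideal_mult[OF u] shell_subset[OF \<pi>1 order_refl]]) auto
      moreover have "\<epsilon> * \<pi> * a\<^sup>2 - (z + u)\<^sup>2 * \<pi> = (\<epsilon> * \<pi> * a\<^sup>2 - z\<^sup>2 * \<pi>) + - (u * (z + u + z) * \<pi>)"
        by (simp add: power2_eq_square algebra_simps)
      ultimately show ?thesis
        using norm_group_cong[OF two \<pi> sh] shell_nonzero[OF sh] shell_nonzero[OF shell_add[OF sh]]
        by (simp only: quad_char_def)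
    qed
    ultimately show "F (torus_elem \<pi> (z + u)) = F (torus_elem \<pi> z)"
      by (simp only: F_eq)
  qed
  also have "\<dots> = (\<Sum>w\<in>residue_reps. \<Phi> (d * w) * of_int (quad_char \<pi> (\<epsilon> * \<pi> * a\<^sup>2 - (a * w)\<^sup>2 * \<pi>)))"
    by (simp add: F_eq d_def ac_simps)
  also have "\<dots> = 2 * ?W"
    by (rule sum_quad_char_eq[OF \<Phi> cond two \<pi> \<epsilon>0 \<epsilon> d shell_nonzero[OF a]])
  finally have sum: "(\<Sum>C\<in>torus_quotient \<pi> r. F (SOME Z. Z \<in> C)) = 2 * ?W" .
  have "abs_val (disc_g Y) = q powi (- (2 * m + 1))"
  proof -
    have "(4::'k) = 2\<^sup>2"
      by simp
    then have "(4::'k) \<in> shell 0"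
      using shell_power[OF shell_two[OF two], of 2] by simp
    moreover have "s\<^sup>2 * \<theta>' \<in> shell (2 * m + 1)"
      using assms(7,8) j ord_s by (simp add: shell_def ord_mult ord_power)
    ultimately have "4 * (s\<^sup>2 * \<theta>') \<in> shell (0 + (2 * m + 1))"
      by (rule shell_mult)
    then show ?thesis
      unfolding assms(11) disc_g_torus_elem q_def by (intro abs_val_shell) simp
  qed
  also have "\<dots> = q powr (- (2 * of_int m + 1))"
    using q by (simp add: powr_real_of_int'[symmetric])
  finally have "abs_val (disc_g Y) powr (- 1 / 2) = q powr (- (2 * of_int m + 1) * (- 1 / 2))"
    by (simp only: powr_powr)
  also have "- (2 * of_int m + 1) * (- 1 / 2) = (of_int m + 1 / 2 :: real)"
    by (simp add: field_simps)
  finally have "abs_val (disc_g Y) powr (- 1 / 2) = q powr (of_int m + 1 / 2)" .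
  \<comment> \<open>The exponents are -(m + 2), -1/2 and m + 1/2, as h = m + 1; they add up to
    -2.\<close>
  then have "q powr (- (h + 1)) * q powr (- 1 / 2) * abs_val (disc_g Y) powr (- 1 / 2) = q powr (- 2)"
    by (simp add: h powr_add[symmetric])
  also have "\<dots> = inverse (q\<^sup>2)"
    using q by (simp add: powr_minus powr_numeral)
  finally have "1 / 2 * q powr (- (h + 1)) * q powr (- 1 / 2) * abs_val (disc_g Y) powr (- 1 / 2) =
      1 / 2 * inverse (q\<^sup>2)"
    by (simp only: mult.assoc)
  \<comment> \<open>The factor 1/2 of the formula cancels the 2 that comes from writing the sign as
    twice an indicator minus 1.\<close>
  then show ?thesis
    unfolding lhs Let_def F_def[symmetric] sum by simp
qed

end
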